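(* Let $\mathbb F$ be a field, $f$ an $\mathbb F$-valued graph parameter and $k\ge0$ an integer. Assume that for some integer $n_k\ge2$ we have $\operatorname{rk_\mathsf S}T(f,k,n_k)=r\le n_k-1$. Then: (1) $\operatorname{rk_\mathsf S}T(f,k,n)=r$ for every integer $n\ge2$; (2) there exist $r$ linearly independent algebra homomorphisms $\mathbf x_1,\dots,\mathbf x_r:\mathcal G[k]\to\mathbb F$ and $a_1,\dots,a_r\in\mathbb F\setminus\{0\}$ such that $f|_{\mathcal G[k]}=\sum_{i=1}^ra_i\mathbf x_i$ and, for every integer $n\ge0$, $T(f,k,n)=\sum_{i=1}^ra_i\mathbf x_i^{\otimes n}$. Moreover, for any $n\ge3$, any expression $T(f,k,n)=\sum_{i=1}^rb_i\mathbf y_i^{\otimes n}$ with $b_i\in\mathbb F$ and linear maps $\mathbf y_i:\mathcal G[k]\to\mathbb F$ is a permutation of the sum $\sum_{i=1}^ra_i\mathbf x_i^{\otimes n}$.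
   Context: Graphs are finite, may have multiple edges but no loops; an $\mathbb F$-valued graph parameter is an isomorphism-invariant function from graphs to $\mathbb F$. For $k\ge0$, a $k$-labeled graph is a graph in which $k$ distinct nodes carry labels $1,\dots,k$, identified up to label-preserving isomorphism; graph parameters ignore labels. The product of two $k$-labeled graphs is their disjoint union with equally-labeled nodes identified; this makes the set $\mathcal{PLG}[k]$ of $k$-labeled graphs a commutative monoid with identity $U_k$ (the edgeless graph on $k$ labeled nodes). $\mathcal G[k]$ is the monoid algebra $\mathbb F\mathcal{PLG}[k]$ (finite formal $\mathbb F$-linear combinations of $k$-labeled graphs), a commutative $\mathbb F$-algebra with identity $U_k$; $f$ is extended linearly to $\mathcal G[k]$. An algebra homomorphism $\mathbf x:\mathcal G[k]\to\mathbb F$ is a linear map with $\mathbf x(gh)=\mathbf x(g)\mathbf x(h)$ and $\mathbf x(U_k)=1$. Elements of $\mathbb F^{\mathcal{PLG}[k]}$ are identified with linear maps $\mathcal G[k]\to\mathbb F$. The connection tensor $T(f,k,n)$ is the function on $\mathcal{PLG}[k]^n$ given by $(G_1,\dots,G_n)\mapsto f(G_1\cdots G_n)$ (for $n=0$ the scalar $f(U_k)$). For $\mathbf x\in\mathbb F^{\mathcal{PLG}[k]}$, $\mathbf x^{\otimes n}(G_1,\dots,G_n)=\prod_i\mathbf x(G_i)$, $\mathbf x^{\otimes0}=1$. $\operatorname{rk_\mathsf S}T$ is the least $r\ge0$ such that $T=\sum_{i=1}^r\lambda_i\mathbf x_i^{\otimes n}$ with $\lambda_i\in\mathbb F$, $\mathbf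 x_i\in\mathbb F^{\mathcal{PLG}[k]}$ ($\infty$ if none). *)

theory Defs
  imports
    "HOL-Library.Poly_Mapping"
    "HOL-Library.Multiset"
    "HOL-Library.Extended_Nat"
    "HOL-Combinatorics.Permutations"
begin

section \<open>Multigraphs\<close>

text \<open>
  A finite graph without loops, possibly with multiple edges: a finite set of nodes and a multiset
  of two-element sets of nodes.  Nodes are natural numbers, so that every finite graph occurs up to
  isomorphism.
\<close>

typedef multigraph =
  "{(V :: nat set, E :: nat set multiset). finite V \<and> (\<forall>e \<in># E. e \<subseteq> V \<and> card e = 2)}"
  by (rule exI[of _ "({}, {#})"]) simp

definition nodes :: "multigraph \<Rightarrow> nat set" where
  "nodes G = fst (Rep_multigraph G)"

definition edges :: "multigraph \<Rightarrow> nat set multiset" where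
  "edges G = snd (Rep_multigraph G)"

lemma finite_nodes [simp]: "finite (nodes G)"
  using Rep_multigraph[of G] by (auto simp: nodes_def)

lemma edges_wf: "e \<in># edges G \<Longrightarrow> e \<subseteq> nodes G \<and> card e = 2"
  using Rep_multigraph[of G] by (simp add: nodes_def edges_def case_prod_beta)

lemma nodes_Abs_multigraph [simp]:
  "finite V \<Longrightarrow> (\<And>e. e \<in># E \<Longrightarrow> e \<subseteq> V \<and> card e = 2) \<Longrightarrow> nodes (Abs_multigraph (V, E)) = V"
  by (simp add: nodes_def Abs_multigraph_inverse)

lemma edges_Abs_multigraph [simp]:
  "finite V \<Longrightarrow> (\<And>e. e \<in># E \<Longrightarrow> e \<subseteq> V \<and> card e = 2) \<Longrightarrow> edges (Abs_multigraph (V, E)) = E"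
  by (simp add: edges_def Abs_multigraph_inverse)

lemma edgeless_Abs_multigraph [simp]:
  assumes "finite V"
  shows "nodes (Abs_multigraph (V, {#})) = V" "edges (Abs_multigraph (V, {#})) = {#}"
  using assms by (auto intro!: nodes_Abs_multigraph edges_Abs_multigraph)

definition graph_isomorphism :: "(nat \<Rightarrow> nat) \<Rightarrow> multigraph \<Rightarrow> multigraph \<Rightarrow> bool" where
  "graph_isomorphism \<theta> G H \<longleftrightarrow>
     bij_betw \<theta> (nodes G) (nodes H) \<and> edges H = image_mset (image \<theta>) (edges G)"

definition graph_parameter :: "(multigraph \<Rightarrow> 'a) \<Rightarrow> bool" where
  "graph_parameter f \<longleftrightarrow> (\<forall>G H \<theta>. graph_isomorphism \<theta> G H \<longrightarrow> f G = f H)"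


section \<open>Partially labeled graphs\<close>

text \<open>
  A labeling sends finitely many labels to pairwise distinct nodes.  The set of labels of a graph is
  left open here; requiring it to be \<open>{1..k}\<close> gives the \<open>k\<close>-labeled graphs.
\<close>

definition wf_labeled :: "multigraph \<times> (nat \<rightharpoonup> nat) \<Rightarrow> bool" where
  "wf_labeled = (\<lambda>(G, L). ran L \<subseteq> nodes G \<and> inj_on L (dom L))"

definition labeled_iso ::
    "multigraph \<times> (nat \<rightharpoonup> nat) \<Rightarrow> multigraph \<times> (nat \<rightharpoonup> nat) \<Rightarrow> bool" where
  "labeled_iso X Y \<longleftrightarrow> wf_labeled X \<and> wf_labeled Y \<and>
     (\<exists>\<theta>. graph_isomorphism \<theta> (fst X) (fst Y) \<and> snd Y = map_option \<theta> \<circ> snd X)"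

lemma wf_labeled_inj:
  "wf_labeled (G, L) \<Longrightarrow> L l = Some v \<Longrightarrow> L l' = Some v \<Longrightarrow> l = l'"
  by (auto simp: wf_labeled_def inj_on_def dom_def)

lemma wf_labeled_node: "wf_labeled (G, L) \<Longrightarrow> L l = Some v \<Longrightarrow> v \<in> nodes G"
  by (auto simp: wf_labeled_def ran_def)

lemma labeled_iso_refl: "wf_labeled X \<Longrightarrow> labeled_iso X X"
  unfolding labeled_iso_def graph_isomorphism_def
  by (auto intro!: exI[of _ id] simp: option.map_id)

lemma labeled_iso_sym:
  assumes "labeled_iso X Y" shows "labeled_iso Y X"
proof -
  obtain G L H M where XY: "X = (G, L)" "Y = (H, M)" by (metis surj_pair)
  obtain \<theta> where b: "bij_betw \<theta> (nodes G) (nodes H)"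
    and e: "edges H = image_mset (image \<theta>) (edges G)" and l: "M = map_option \<theta> \<circ> L"
    and wf: "wf_labeled X" "wf_labeled Y"
    using assms unfolding labeled_iso_def graph_isomorphism_def XY by auto
  let ?i = "inv_into (nodes G) \<theta>"
  have inj: "inj_on \<theta> (nodes G)" using b by (simp add: bij_betw_def)
  have "image_mset (image ?i) (edges H) = image_mset (\<lambda>e. e) (edges G)"
    unfolding e multiset.map_comp
  proof (rule image_mset_cong)
    fix x assume "x \<in># edges G"
    then have "x \<subseteq> nodes G" using edges_wf by blast
    then show "(image ?i \<circ> image \<theta>) x = x" using inj by simp
  qed
  moreover have "L = map_option ?i \<circ> M"
  proof
    fix x show "L x = (map_option ?i \<circ> M) x"
    proof (cases "L x")
      case (Some v)
      then have "v \<in> nodes G" using wf(1) unfolding XY by (rule wf_labeled_node[rotated])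
      then show ?thesis using Some l inj by simp
    qed (simp add: l)
  qed
  ultimately show ?thesis using wf bij_betw_inv_into[OF b]
    unfolding labeled_iso_def graph_isomorphism_def XY by (auto intro!: exI[of _ ?i])
qed

lemma labeled_iso_trans:
  assumes "labeled_iso X Y" "labeled_iso Y Z" shows "labeled_iso X Z"
proof -
  obtain \<theta> where b: "graph_isomorphism \<theta> (fst X) (fst Y)" and l: "snd Y = map_option \<theta> \<circ> snd X"
    and wf: "wf_labeled X" "wf_labeled Y"
    using assms unfolding labeled_iso_def by auto
  obtain \<eta> where b': "graph_isomorphism \<eta> (fst Y) (fst Z)"
    and l': "snd Z = map_option \<eta> \<circ> snd Y" and wf': "wf_labeled Z"
    using assms unfolding labeled_iso_def by auto
  have "graph_isomorphism (\<eta> \<circ> \<theta>) (fst X) (fst Z)"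
    using b b' unfolding graph_isomorphism_def
    by (auto simp: multiset.map_comp image_comp comp_def intro: bij_betw_trans[unfolded comp_def])
  moreover have "snd Z = map_option (\<eta> \<circ> \<theta>) \<circ> snd X"
    by (simp add: l l' fun_eq_iff option.map_comp)
  ultimately show ?thesis using wf wf' unfolding labeled_iso_def by blast
qed

quotient_type plgraph = "multigraph \<times> (nat \<rightharpoonup> nat)" / partial: labeled_iso
proof (rule part_equivpI)
  show "\<exists>X. labeled_iso X X"
    by (rule exI[of _ "(Abs_multigraph ({}, {#}), Map.empty)"])
       (rule labeled_iso_refl, simp add: wf_labeled_def)
  show "symp labeled_iso" by (rule sympI) (rule labeled_iso_sym)
  show "transp labeled_iso" by (rule transpI) (rule labeled_iso_trans)
qed

lift_definition labels :: "plgraph \<Rightarrow> nat set" is "\<lambda>X. dom (snd X)"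
  by (auto simp: labeled_iso_def dom_def)

definition PLG :: "nat \<Rightarrow> plgraph set" where
  "PLG k = {G. labels G = {1..k}}"

lift_definition edgeless :: "nat \<Rightarrow> plgraph" is
  "\<lambda>k. (Abs_multigraph ({1..k}, {#}), \<lambda>i. if i \<in> {1..k} then Some i else None)"
  by (rule labeled_iso_refl) (auto simp: wf_labeled_def ran_def inj_on_def split: if_splits)

text \<open>
  The value of \<open>f\<close> at a labeled graph, ignoring the labels.  The choice of the representative is
  irrelevant when \<open>f\<close> is a graph parameter, see \<open>unlabeled_value_abs\<close>.
\<close>

definition unlabeled_value :: "(multigraph \<Rightarrow> 'a) \<Rightarrow> plgraph \<Rightarrow> 'a" where
  "unlabeled_value f G = f (fst (rep_plgraph G))"

lemma unlabeled_value_abs: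
  assumes "graph_parameter f" "wf_labeled X"
  shows "unlabeled_value f (abs_plgraph X) = f (fst X)"
proof -
  have "labeled_iso X (rep_plgraph (abs_plgraph X))"
    using Quotient3_rep_abs[OF Quotient3_plgraph] labeled_iso_refl[OF assms(2)]
    by (meson labeled_iso_sym)
  then show ?thesis
    using assms(1) unfolding unlabeled_value_def graph_parameter_def labeled_iso_def by metis
qed


section \<open>The gluing product\<close>

text \<open>
  To form the disjoint union of \<open>(G, L)\<close> and \<open>(H, M)\<close> the nodes of \<open>G\<close> are renamed to even and those
  of \<open>H\<close> to odd numbers, except that a node of \<open>H\<close> sharing its label with a node of \<open>G\<close> gets the name
  of the latter.
\<close>

definition glue_rename :: "(nat \<rightharpoonup> nat) \<Rightarrow> (nat \<rightharpoonup> nat) \<Rightarrow> nat \<Rightarrow> nat" where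
  "glue_rename L M w =
     (if \<exists>l v. L l = Some v \<and> M l = Some w
      then 2 * (THE v. \<exists>l. L l = Some v \<and> M l = Some w)
      else 2 * w + 1)"

definition glue_raw ::
    "multigraph \<times> (nat \<rightharpoonup> nat) \<Rightarrow> multigraph \<times> (nat \<rightharpoonup> nat) \<Rightarrow> multigraph \<times> (nat \<rightharpoonup> nat)" where
  "glue_raw X Y =
     (let \<alpha> = \<lambda>v. 2 * v;
          \<beta> = glue_rename (snd X) (snd Y)
      in (Abs_multigraph (\<alpha> ` nodes (fst X) \<union> \<beta> ` nodes (fst Y),
            image_mset (image \<alpha>) (edges (fst X)) + image_mset (image \<beta>) (edges (fst Y))),
          (map_option \<beta> \<circ> snd Y) ++ (map_option \<alpha> \<circ> snd X)))"

text \<open>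
  A characterization up to isomorphism of gluings of several graphs, from which the monoid laws are
  derived.
\<close>

definition is_gluing ::
    "'i set \<Rightarrow> ('i \<Rightarrow> multigraph \<times> (nat \<rightharpoonup> nat)) \<Rightarrow> ('i \<Rightarrow> nat \<Rightarrow> nat)
      \<Rightarrow> multigraph \<times> (nat \<rightharpoonup> nat) \<Rightarrow> bool" where
  "is_gluing I X \<phi> K \<longleftrightarrow> finite I \<and> wf_labeled K \<and> (\<forall>i\<in>I. wf_labeled (X i)) \<and>
     (\<forall>i\<in>I. \<forall>j\<in>I. \<forall>v\<in>nodes (fst (X i)). \<forall>w\<in>nodes (fst (X j)).
        \<phi> i v = \<phi> j w \<longleftrightarrow>
          (i = j \<and> v = w) \<or> (\<exists>l. snd (X i) l = Some v \<and> snd (X j) l = Some w)) \<and>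
     nodes (fst K) = (\<Union>i\<in>I. \<phi> i ` nodes (fst (X i))) \<and>
     edges (fst K) = (\<Sum>i\<in>I. image_mset (image (\<phi> i)) (edges (fst (X i)))) \<and>
     (\<forall>l u. snd K l = Some u \<longleftrightarrow> (\<exists>i\<in>I. \<exists>v. snd (X i) l = Some v \<and> u = \<phi> i v))"

lemma is_gluing_unique:
  assumes K: "is_gluing I X \<phi> K" and K': "is_gluing I X' \<phi>' K'"
    and iso: "\<And>i. i \<in> I \<Longrightarrow> labeled_iso (X i) (X' i)"
  shows "labeled_iso K K'"
proof -
  have "\<forall>i\<in>I. \<exists>\<sigma>. graph_isomorphism \<sigma> (fst (X i)) (fst (X' i)) \<and>
      snd (X' i) = map_option \<sigma> \<circ> snd (X i)"
    using iso unfolding labeled_iso_def by blast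
  then obtain \<sigma> where s: "\<And>i. i \<in> I \<Longrightarrow> graph_isomorphism (\<sigma> i) (fst (X i)) (fst (X' i))"
    and sl: "\<And>i. i \<in> I \<Longrightarrow> snd (X' i) = map_option (\<sigma> i) \<circ> snd (X i)"
    by metis
  have sb: "bij_betw (\<sigma> i) (nodes (fst (X i))) (nodes (fst (X' i)))" if "i \<in> I" for i
    using s[OF that] by (simp add: graph_isomorphism_def)
  have smem: "\<sigma> i v \<in> nodes (fst (X' i))" if "i \<in> I" "v \<in> nodes (fst (X i))" for i v
    using sb[OF that(1)] that(2) by (auto simp: bij_betw_def)
  have wfX: "wf_labeled (X i)" if "i \<in> I" for i using K that by (simp add: is_gluing_def)
  have lnode: "v \<in> nodes (fst (X i))" if "i \<in> I" "snd (X i) l = Some v" for i l v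
    using wf_labeled_node[of "fst (X i)" "snd (X i)"] wfX[OF that(1)] that(2) by simp
  have lab: "(\<exists>l. snd (X' i) l = Some (\<sigma> i v) \<and> snd (X' j) l = Some (\<sigma> j w)) \<longleftrightarrow>
      (\<exists>l. snd (X i) l = Some v \<and> snd (X j) l = Some w)"
    if "i \<in> I" "j \<in> I" "v \<in> nodes (fst (X i))" "w \<in> nodes (fst (X j))" for i j v w
  proof -
    have *: "snd (X' i) l = Some (\<sigma> i v) \<longleftrightarrow> snd (X i) l = Some v"
      if "i \<in> I" "v \<in> nodes (fst (X i))" for i v l
      using sl[OF that(1)] sb[OF that(1)] lnode[OF that(1), of l] that(2)
      by (auto simp: bij_betw_def inj_on_def)
    show ?thesis using * that by simp
  qed
  have key: "\<phi>' i (\<sigma> i v) = \<phi>' j (\<sigma> j w) \<longleftrightarrow> \<phi> i v = \<phi> j w"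
    if ij: "i \<in> I" "j \<in> I" and vw: "v \<in> nodes (fst (X i))" "w \<in> nodes (fst (X j))" for i j v w
  proof -
    have 1: "\<phi> i v = \<phi> j w \<longleftrightarrow>
          (i = j \<and> v = w) \<or> (\<exists>l. snd (X i) l = Some v \<and> snd (X j) l = Some w)"
      using K ij vw unfolding is_gluing_def by blast
    have 2: "\<phi>' i (\<sigma> i v) = \<phi>' j (\<sigma> j w) \<longleftrightarrow> (i = j \<and> \<sigma> i v = \<sigma> j w) \<or>
          (\<exists>l. snd (X' i) l = Some (\<sigma> i v) \<and> snd (X' j) l = Some (\<sigma> j w))"
      using K' ij smem[OF ij(1) vw(1)] smem[OF ij(2) vw(2)] unfolding is_gluing_def by blast
    have 3: "i = j \<and> \<sigma> i v = \<sigma> j w \<longleftrightarrow> i = j \<and> v = w"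
      using sb[OF ij(1)] vw by (auto simp: bij_betw_def inj_on_def)
    show ?thesis unfolding 1 2 3 lab[OF ij vw] by simp
  qed
  define \<theta> where "\<theta> u = (SOME z. \<exists>i\<in>I. \<exists>v\<in>nodes (fst (X i)). u = \<phi> i v \<and> z = \<phi>' i (\<sigma> i v))" for u
  have th: "\<theta> (\<phi> i v) = \<phi>' i (\<sigma> i v)" if "i \<in> I" "v \<in> nodes (fst (X i))" for i v
    unfolding \<theta>_def
  proof (rule some_equality)
    show "\<exists>j\<in>I. \<exists>w\<in>nodes (fst (X j)). \<phi> i v = \<phi> j w \<and> \<phi>' i (\<sigma> i v) = \<phi>' j (\<sigma> j w)"
      using that by blast
    show "z = \<phi>' i (\<sigma> i v)"
      if "\<exists>j\<in>I. \<exists>w\<in>nodes (fst (X j)). \<phi> i v = \<phi> j w \<and> z = \<phi>' j (\<sigma> j w)" for z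
      using that key \<open>i \<in> I\<close> \<open>v \<in> nodes (fst (X i))\<close> by metis
  qed
  have nK: "nodes (fst K) = (\<Union>i\<in>I. \<phi> i ` nodes (fst (X i)))"
    and nK': "nodes (fst K') = (\<Union>i\<in>I. \<phi>' i ` nodes (fst (X' i)))"
    using K K' by (simp_all add: is_gluing_def)
  have "inj_on \<theta> (nodes (fst K))"
  proof (rule inj_onI)
    fix x y assume "x \<in> nodes (fst K)" "y \<in> nodes (fst K)" and eq: "\<theta> x = \<theta> y"
    then obtain i v j w where "i \<in> I" "v \<in> nodes (fst (X i))" "x = \<phi> i v"
      "j \<in> I" "w \<in> nodes (fst (X j))" "y = \<phi> j w" unfolding nK by blast
    then show "x = y" using eq th key by metis
  qed
  moreover have "\<theta> ` nodes (fst K) = nodes (fst K')"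
  proof -
    have "\<theta> ` nodes (fst K) = (\<Union>i\<in>I. (\<lambda>v. \<theta> (\<phi> i v)) ` nodes (fst (X i)))"
      unfolding nK by blast
    also have "\<dots> = (\<Union>i\<in>I. (\<lambda>v. \<phi>' i (\<sigma> i v)) ` nodes (fst (X i)))"
      using th by (intro SUP_cong image_cong) auto
    also have "\<dots> = (\<Union>i\<in>I. \<phi>' i ` (\<sigma> i ` nodes (fst (X i))))"
      by (simp add: image_image)
    also have "\<dots> = nodes (fst K')"
      unfolding nK' using sb by (intro SUP_cong) (auto simp: bij_betw_def)
    finally show ?thesis .
  qed
  moreover have "edges (fst K') = image_mset (image \<theta>) (edges (fst K))"
  proof -
    have fin: "finite I" using K by (simp add: is_gluing_def)
    have sum: "image_mset h (\<Sum>i\<in>I. F i) = (\<Sum>i\<in>I. image_mset h (F i))"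
      for h :: "nat set \<Rightarrow> nat set" and F
      using fin by (induction I rule: finite_induct) auto
    have "image_mset (image \<theta>) (edges (fst K))
        = (\<Sum>i\<in>I. image_mset (image \<theta>) (image_mset (image (\<phi> i)) (edges (fst (X i)))))"
      using K sum by (simp add: is_gluing_def)
    also have "\<dots> = (\<Sum>i\<in>I. image_mset (image (\<phi>' i)) (edges (fst (X' i))))"
    proof (rule sum.cong)
      fix i assume i: "i \<in> I"
      have e: "edges (fst (X' i)) = image_mset (image (\<sigma> i)) (edges (fst (X i)))"
        using s[OF i] by (simp add: graph_isomorphism_def)
      show "image_mset (image \<theta>) (image_mset (image (\<phi> i)) (edges (fst (X i))))
          = image_mset (image (\<phi>' i)) (edges (fst (X' i)))"
        unfolding e multiset.map_comp
      proof (rule image_mset_cong)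
        fix e assume "e \<in># edges (fst (X i))"
        then have "e \<subseteq> nodes (fst (X i))" using edges_wf by blast
        then show "((`) \<theta> \<circ> (`) (\<phi> i)) e = ((`) (\<phi>' i) \<circ> (`) (\<sigma> i)) e"
          using th[OF i] by (force simp: image_image)
      qed
    qed simp
    also have "\<dots> = edges (fst K')" using K' by (simp add: is_gluing_def)
    finally show ?thesis by simp
  qed
  moreover have "snd K' = map_option \<theta> \<circ> snd K"
  proof
    fix l
    have A: "snd K l = Some u \<longleftrightarrow> (\<exists>i\<in>I. \<exists>v. snd (X i) l = Some v \<and> u = \<phi> i v)" for u
      using K unfolding is_gluing_def by blast
    have B: "snd K' l = Some u \<longleftrightarrow> (\<exists>i\<in>I. \<exists>v. snd (X' i) l = Some v \<and> u = \<phi>' i v)" for u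
      using K' unfolding is_gluing_def by blast
    show "snd K' l = (map_option \<theta> \<circ> snd K) l"
    proof (cases "snd K l")
      case None
      have "snd K' l = None"
      proof (rule ccontr)
        assume "snd K' l \<noteq> None"
        then obtain i v where "i \<in> I" "snd (X' i) l = Some v" using B by auto
        then obtain w where "snd (X i) l = Some w" using sl by (auto simp: comp_def)
        then show False using A None \<open>i \<in> I\<close> by auto
      qed
      then show ?thesis using None by simp
    next
      case (Some u)
      then obtain i v where i: "i \<in> I" "snd (X i) l = Some v" "u = \<phi> i v" using A by blast
      then have "snd (X' i) l = Some (\<sigma> i v)" using sl by simp
      then have "snd K' l = Some (\<phi>' i (\<sigma> i v))" using B i by blast
      then show ?thesis using Some i th lnode by simp
    qed
  qed
  ultimately show ?thesis
    using K K' unfolding labeled_iso_def graph_isomorphism_def is_gluing_def bij_betw_def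
    by (intro conjI exI[of _ \<theta>]) blast+
qed

lemma glue_rename_eq:
  assumes "wf_labeled (G, L)" "wf_labeled (H, M)" "L l = Some v" "M l = Some w"
  shows "glue_rename L M w = 2 * v"
proof -
  have "(THE v. \<exists>l. L l = Some v \<and> M l = Some w) = v"
    using assms wf_labeled_inj by (intro the_equality) (auto, metis option.inject)
  moreover have "\<exists>l v. L l = Some v \<and> M l = Some w" using assms by blast
  ultimately show ?thesis unfolding glue_rename_def by (simp only: if_True)
qed

lemma glue_raw_is_gluing:
  assumes X: "wf_labeled X" and Y: "wf_labeled Y"
  shows "\<exists>\<alpha> \<beta>. is_gluing UNIV (\<lambda>b. if b then Y else X) (\<lambda>b. if b then \<beta> else \<alpha>) (glue_raw X Y)"
proof -
  obtain G L H M where XY: "X = (G, L)" "Y = (H, M)" by (metis surj_pair)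
  define \<alpha> where "\<alpha> = (\<lambda>v::nat. 2 * v)"
  define \<beta> where "\<beta> = glue_rename L M"
  note wf = X[unfolded XY] Y[unfolded XY]
  have ab: "\<alpha> v = \<beta> w \<longleftrightarrow> (\<exists>l. L l = Some v \<and> M l = Some w)" for v w
  proof
    assume a: "\<alpha> v = \<beta> w"
    have "\<exists>l v. L l = Some v \<and> M l = Some w"
    proof (rule ccontr)
      assume "\<not> ?thesis"
      then have "\<beta> w = 2 * w + 1" unfolding \<beta>_def glue_rename_def by (simp only: if_False)
      then show False using a unfolding \<alpha>_def by presburger
    qed
    then obtain l v' where "L l = Some v'" "M l = Some w" by blast
    moreover from this have "\<beta> w = 2 * v'" unfolding \<beta>_def using glue_rename_eq wf by blast
    ultimately show "\<exists>l. L l = Some v \<and> M l = Some w" using a by (auto simp: \<alpha>_def)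
  next
    assume "\<exists>l. L l = Some v \<and> M l = Some w"
    then show "\<alpha> v = \<beta> w" unfolding \<beta>_def \<alpha>_def using glue_rename_eq wf by metis
  qed
  have bb: "\<beta> w = \<beta> w' \<longleftrightarrow> w = w'" for w w'
  proof
    assume eq: "\<beta> w = \<beta> w'"
    show "w = w'"
    proof (cases "\<exists>l v. L l = Some v \<and> M l = Some w")
      case True
      then obtain l v where lv: "L l = Some v" "M l = Some w" by blast
      then have "\<alpha> v = \<beta> w" using ab by blast
      then have "\<alpha> v = \<beta> w'" using eq by simp
      then obtain l' where "L l' = Some v" "M l' = Some w'" using ab by blast
      then show ?thesis using lv wf_labeled_inj[OF wf(1)] by force
    next
      case False
      then have w: "\<beta> w = 2 * w + 1" unfolding \<beta>_def glue_rename_def by (simp only: if_False)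
      show ?thesis
      proof (cases "\<exists>l v. L l = Some v \<and> M l = Some w'")
        case True
        then obtain v where "\<alpha> v = \<beta> w'" using ab by blast
        then have "2 * v = 2 * w + 1" using eq w by (simp add: \<alpha>_def)
        then show ?thesis by presburger
      next
        case False
        then have "\<beta> w' = 2 * w' + 1" unfolding \<beta>_def glue_rename_def by (simp only: if_False)
        then show ?thesis using eq w by simp
      qed
    qed
  qed simp
  have aa: "\<alpha> v = \<alpha> v' \<longleftrightarrow> v = v'" for v v' by (simp add: \<alpha>_def)
  let ?V = "\<alpha> ` nodes G \<union> \<beta> ` nodes H"
  let ?E = "image_mset (image \<alpha>) (edges G) + image_mset (image \<beta>) (edges H)"
  let ?P = "(map_option \<beta> \<circ> M) ++ (map_option \<alpha> \<circ> L)"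
  have g: "glue_raw X Y = (Abs_multigraph (?V, ?E), ?P)"
    by (simp add: glue_raw_def XY \<alpha>_def \<beta>_def Let_def)
  have E: "e \<subseteq> ?V \<and> card e = 2" if e: "e \<in># ?E" for e
  proof -
    have injs: "inj \<alpha>" "inj \<beta>" using aa bb by (auto simp: inj_on_def)
    from e consider d where "d \<in># edges G" "e = \<alpha> ` d" | d where "d \<in># edges H" "e = \<beta> ` d"
      by auto
    then show ?thesis
    proof cases
      case 1 then show ?thesis
        using edges_wf[OF 1(1)] injs by (auto simp: card_image inj_on_subset[of _ UNIV])
    next
      case 2 then show ?thesis
        using edges_wf[OF 2(1)] injs by (auto simp: card_image inj_on_subset[of _ UNIV])
    qed
  qed
  have N: "nodes (fst (glue_raw X Y)) = ?V" "edges (fst (glue_raw X Y)) = ?E"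
    unfolding g fst_conv by (rule nodes_Abs_multigraph edges_Abs_multigraph; use E in simp)+
  have P: "?P l = Some u \<longleftrightarrow> (\<exists>v. L l = Some v \<and> u = \<alpha> v) \<or> (\<exists>w. M l = Some w \<and> u = \<beta> w)" for l u
    using ab by (cases "L l"; cases "M l") (auto simp: map_add_def)
  have wfK: "wf_labeled (glue_raw X Y)"
    unfolding wf_labeled_def case_prod_beta N
  proof (intro conjI subsetI inj_onI)
    fix u assume "u \<in> ran (snd (glue_raw X Y))"
    then obtain l where "?P l = Some u" unfolding ran_def g snd_conv mem_Collect_eq by (elim exE)
    then show "u \<in> ?V" unfolding P using wf_labeled_node[OF wf(1)] wf_labeled_node[OF wf(2)] by auto
  next
    fix l l' assume dom: "l \<in> dom (snd (glue_raw X Y))" and eq: "snd (glue_raw X Y) l = snd (glue_raw X Y) l'"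
    from eq have eq': "?P l = ?P l'" unfolding g snd_conv .
    from dom have "?P l \<noteq> None" unfolding dom_def g snd_conv mem_Collect_eq .
    then obtain u where "?P l = Some u" by (cases "?P l") simp_all
    with eq' have u: "?P l = Some u" "?P l' = Some u" by simp_all
    show "l = l'"
    proof -
      have P': "(\<exists>v. L l = Some v \<and> u = \<alpha> v) \<or> (\<exists>w. M l = Some w \<and> u = \<beta> w)"
        "(\<exists>v. L l' = Some v \<and> u = \<alpha> v) \<or> (\<exists>w. M l' = Some w \<and> u = \<beta> w)"
        using u unfolding P by blast+
      have mix: "l = l'" if "L l = Some v" "M l' = Some w" "\<alpha> v = \<beta> w" for l l' v w
      proof -
        from that(3) obtain l0 where l0: "L l0 = Some v" "M l0 = Some w" unfolding ab by (elim exE conjE)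
        have "l = l0" by (rule wf_labeled_inj[OF wf(1) that(1) l0(1)])
        also have "l0 = l'" by (rule wf_labeled_inj[OF wf(2) l0(2) that(2)])
        finally show ?thesis .
      qed
      have LL: "l = l'" if "L l = Some v" "L l' = Some w" "\<alpha> v = \<alpha> w" for l l' v w
        by (rule wf_labeled_inj[OF wf(1) that(1)]) (use that(2,3) in \<open>simp add: aa\<close>)
      have MM: "l = l'" if "M l = Some v" "M l' = Some w" "\<beta> v = \<beta> w" for l l' v w
        by (rule wf_labeled_inj[OF wf(2) that(1)]) (use that(2,3) in \<open>simp add: bb\<close>)
      from P'(1) show ?thesis
      proof (elim disjE exE conjE)
        fix v assume v: "L l = Some v" "u = \<alpha> v"
        from P'(2) show ?thesis
        proof (elim disjE exE conjE)
          fix v' assume v': "L l' = Some v'" "u = \<alpha> v'"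
          show ?thesis by (rule LL[OF v(1) v'(1)]) (use v v' in simp)
        next
          fix v' assume v': "M l' = Some v'" "u = \<beta> v'"
          show ?thesis by (rule mix[OF v(1) v'(1)]) (use v v' in simp)
        qed
      next
        fix v assume v: "M l = Some v" "u = \<beta> v"
        from P'(2) show ?thesis
        proof (elim disjE exE conjE)
          fix v' assume v': "L l' = Some v'" "u = \<alpha> v'"
          show ?thesis by (rule sym, rule mix[OF v'(1) v(1)]) (use v v' in simp)
        next
          fix v' assume v': "M l' = Some v'" "u = \<beta> v'"
          show ?thesis by (rule MM[OF v(1) v'(1)]) (use v v' in simp)
        qed
      qed
    qed
  qed
  have cond: "\<forall>i j. \<forall>v w. (if i then \<beta> else \<alpha>) v = (if j then \<beta> else \<alpha>) w \<longleftrightarrow>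
     (i = j \<and> v = w) \<or> (\<exists>l. snd (if i then Y else X) l = Some v \<and> snd (if j then Y else X) l = Some w)"
  proof (intro allI)
    fix i j v w
    have "\<beta> v = \<alpha> w \<longleftrightarrow> (\<exists>l. M l = Some v \<and> L l = Some w)" using ab[of w v] by (auto simp: eq_commute)
    then show "(if i then \<beta> else \<alpha>) v = (if j then \<beta> else \<alpha>) w \<longleftrightarrow>
     (i = j \<and> v = w) \<or> (\<exists>l. snd (if i then Y else X) l = Some v \<and> snd (if j then Y else X) l = Some w)"
      using ab[of v w] bb[of v w] aa[of v w] by (cases i; cases j) (auto simp: XY)
  qed
  have "is_gluing UNIV (\<lambda>b. if b then Y else X) (\<lambda>b. if b then \<beta> else \<alpha>) (glue_raw X Y)"
    unfolding is_gluing_def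
  proof (intro conjI)
    show "\<forall>i\<in>UNIV. \<forall>j\<in>UNIV. \<forall>v\<in>nodes (fst (if i then Y else X)). \<forall>w\<in>nodes (fst (if j then Y else X)).
      (if i then \<beta> else \<alpha>) v = (if j then \<beta> else \<alpha>) w \<longleftrightarrow>
      (i = j \<and> v = w) \<or> (\<exists>l. snd (if i then Y else X) l = Some v \<and> snd (if j then Y else X) l = Some w)"
      using cond by blast
    show "\<forall>l u. (snd (glue_raw X Y) l = Some u) =
      (\<exists>i\<in>UNIV. \<exists>v. snd (if i then Y else X) l = Some v \<and> u = (if i then \<beta> else \<alpha>) v)"
      using P unfolding g snd_conv by (auto simp: XY UNIV_bool)
  qed (use X Y wfK in \<open>auto simp: N[unfolded XY] XY UNIV_bool add.commute\<close>)
  then show ?thesis by blast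
qed

lemma wf_glue_raw:
  assumes "wf_labeled X" "wf_labeled Y"
  shows "wf_labeled (glue_raw X Y)"
  using glue_raw_is_gluing[OF assms] unfolding is_gluing_def by (elim exE conjE)

lemma glue_raw_cong:
  assumes "labeled_iso X X'" "labeled_iso Y Y'"
  shows "labeled_iso (glue_raw X Y) (glue_raw X' Y')"
proof -
  have "wf_labeled X" "wf_labeled Y" "wf_labeled X'" "wf_labeled Y'"
    using assms by (auto simp: labeled_iso_def)
  then obtain \<phi> \<phi>' where
    "is_gluing UNIV (\<lambda>b. if b then Y else X) \<phi> (glue_raw X Y)"
    "is_gluing UNIV (\<lambda>b. if b then Y' else X') \<phi>' (glue_raw X' Y')"
    using glue_raw_is_gluing by metis
  then show ?thesis by (rule is_gluing_unique) (use assms in auto)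
qed

lemma glue_raw_commute:
  assumes "wf_labeled X" "wf_labeled Y"
  shows "labeled_iso (glue_raw X Y) (glue_raw Y X)"
proof -
  obtain \<alpha> \<beta> \<gamma> \<delta> where
    1: "is_gluing UNIV (\<lambda>b. if b then Y else X) (\<lambda>b. if b then \<beta> else \<alpha>) (glue_raw X Y)" and
    2: "is_gluing UNIV (\<lambda>b. if b then X else Y) (\<lambda>b. if b then \<delta> else \<gamma>) (glue_raw Y X)"
    using glue_raw_is_gluing assms by metis
  have "is_gluing UNIV (\<lambda>b. if b then Y else X) (\<lambda>b. if b then \<gamma> else \<delta>) (glue_raw Y X)"
    using 2 unfolding is_gluing_def
    by (auto simp: UNIV_bool add.commute)
  from is_gluing_unique[OF 1 this] show ?thesis using assms labeled_iso_refl by auto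
qed

lemma glue_raw_gluing2:
  assumes "wf_labeled X" "wf_labeled Y"
  obtains \<alpha> \<beta> where
    "wf_labeled (glue_raw X Y)"
    "\<And>v w. v \<in> nodes (fst X) \<Longrightarrow> w \<in> nodes (fst X) \<Longrightarrow> \<alpha> v = \<alpha> w \<longleftrightarrow> v = w"
    "\<And>v w. v \<in> nodes (fst Y) \<Longrightarrow> w \<in> nodes (fst Y) \<Longrightarrow> \<beta> v = \<beta> w \<longleftrightarrow> v = w"
    "\<And>v w. v \<in> nodes (fst X) \<Longrightarrow> w \<in> nodes (fst Y) \<Longrightarrow>
       \<alpha> v = \<beta> w \<longleftrightarrow> (\<exists>l. snd X l = Some v \<and> snd Y l = Some w)"
    "nodes (fst (glue_raw X Y)) = \<alpha> ` nodes (fst X) \<union> \<beta> ` nodes (fst Y)"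
    "edges (fst (glue_raw X Y)) =
       image_mset (image \<alpha>) (edges (fst X)) + image_mset (image \<beta>) (edges (fst Y))"
    "\<And>l u. snd (glue_raw X Y) l = Some u \<longleftrightarrow>
       (\<exists>v. snd X l = Some v \<and> u = \<alpha> v) \<or> (\<exists>v. snd Y l = Some v \<and> u = \<beta> v)"
proof -
  obtain \<alpha> \<beta> where
    g: "is_gluing UNIV (\<lambda>b. if b then Y else X) (\<lambda>b. if b then \<beta> else \<alpha>) (glue_raw X Y)"
    using glue_raw_is_gluing assms by metis
  have c: "(if i then \<beta> else \<alpha>) v = (if j then \<beta> else \<alpha>) w \<longleftrightarrow> (i = j \<and> v = w) \<or>
      (\<exists>l. snd (if i then Y else X) l = Some v \<and> snd (if j then Y else X) l = Some w)"
    if "v \<in> nodes (fst (if i then Y else X))" "w \<in> nodes (fst (if j then Y else X))" for i j v w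
  proof -
    have "\<forall>i\<in>UNIV. \<forall>j\<in>UNIV. \<forall>v\<in>nodes (fst (if i then Y else X)). \<forall>w\<in>nodes (fst (if j then Y else X)).
      (if i then \<beta> else \<alpha>) v = (if j then \<beta> else \<alpha>) w \<longleftrightarrow> (i = j \<and> v = w) \<or>
      (\<exists>l. snd (if i then Y else X) l = Some v \<and> snd (if j then Y else X) l = Some w)"
      using g unfolding is_gluing_def by (elim conjE)
    from this[rule_format, OF UNIV_I UNIV_I that] show ?thesis .
  qed
  have p: "snd (glue_raw X Y) l = Some u \<longleftrightarrow>
       (\<exists>v. snd X l = Some v \<and> u = \<alpha> v) \<or> (\<exists>v. snd Y l = Some v \<and> u = \<beta> v)" for l u
  proof -
    have "\<forall>l u. snd (glue_raw X Y) l = Some u \<longleftrightarrow>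
        (\<exists>i\<in>UNIV. \<exists>v. snd (if i then Y else X) l = Some v \<and> u = (if i then \<beta> else \<alpha>) v)"
      using g unfolding is_gluing_def by (elim conjE)
    from this[rule_format, of l u] show ?thesis by (auto simp: UNIV_bool)
  qed
  show thesis
  proof (rule that)
    show "wf_labeled (glue_raw X Y)" using g by (simp add: is_gluing_def)
  next
    fix v w assume "v \<in> nodes (fst X)" "w \<in> nodes (fst X)"
    then show "\<alpha> v = \<alpha> w \<longleftrightarrow> v = w" using c[of v False w False] by auto
  next
    fix v w assume "v \<in> nodes (fst Y)" "w \<in> nodes (fst Y)"
    then show "\<beta> v = \<beta> w \<longleftrightarrow> v = w" using c[of v True w True] by auto
  next
    fix v w assume "v \<in> nodes (fst X)" "w \<in> nodes (fst Y)"
    then show "\<alpha> v = \<beta> w \<longleftrightarrow> (\<exists>l. snd X l = Some v \<and> snd Y l = Some w)"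
      using c[of v False w True] by auto
  next
    show "nodes (fst (glue_raw X Y)) = \<alpha> ` nodes (fst X) \<union> \<beta> ` nodes (fst Y)"
      "edges (fst (glue_raw X Y)) =
         image_mset (image \<alpha>) (edges (fst X)) + image_mset (image \<beta>) (edges (fst Y))"
      using g unfolding is_gluing_def by (simp_all add: UNIV_bool Un_commute add.commute)
  qed (rule p)
qed

lemma glue_raw_gluing3:
  assumes X: "wf_labeled X" and Y: "wf_labeled Y" and Z: "wf_labeled Z"
  shows "\<exists>\<phi>. is_gluing {0, 1, 2::nat} (\<lambda>i. if i = 0 then X else if i = 1 then Y else Z) \<phi>
     (glue_raw (glue_raw X Y) Z)"
proof -
  let ?D = "glue_raw X Y"
  obtain \<alpha> \<beta> where D: "wf_labeled ?D"
    "\<And>v w. v \<in> nodes (fst X) \<Longrightarrow> w \<in> nodes (fst X) \<Longrightarrow> \<alpha> v = \<alpha> w \<longleftrightarrow> v = w"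
    "\<And>v w. v \<in> nodes (fst Y) \<Longrightarrow> w \<in> nodes (fst Y) \<Longrightarrow> \<beta> v = \<beta> w \<longleftrightarrow> v = w"
    "\<And>v w. v \<in> nodes (fst X) \<Longrightarrow> w \<in> nodes (fst Y) \<Longrightarrow>
       \<alpha> v = \<beta> w \<longleftrightarrow> (\<exists>l. snd X l = Some v \<and> snd Y l = Some w)"
    "nodes (fst ?D) = \<alpha> ` nodes (fst X) \<union> \<beta> ` nodes (fst Y)"
    "edges (fst ?D) =
       image_mset (image \<alpha>) (edges (fst X)) + image_mset (image \<beta>) (edges (fst Y))"
    "\<And>l u. snd ?D l = Some u \<longleftrightarrow>
       (\<exists>v. snd X l = Some v \<and> u = \<alpha> v) \<or> (\<exists>v. snd Y l = Some v \<and> u = \<beta> v)"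
    by (rule glue_raw_gluing2[OF X Y]) (rule that; assumption)
  let ?K = "glue_raw ?D Z"
  obtain \<gamma> \<delta> where K: "wf_labeled ?K"
    "\<And>v w. v \<in> nodes (fst ?D) \<Longrightarrow> w \<in> nodes (fst ?D) \<Longrightarrow> \<gamma> v = \<gamma> w \<longleftrightarrow> v = w"
    "\<And>v w. v \<in> nodes (fst Z) \<Longrightarrow> w \<in> nodes (fst Z) \<Longrightarrow> \<delta> v = \<delta> w \<longleftrightarrow> v = w"
    "\<And>v w. v \<in> nodes (fst ?D) \<Longrightarrow> w \<in> nodes (fst Z) \<Longrightarrow>
       \<gamma> v = \<delta> w \<longleftrightarrow> (\<exists>l. snd ?D l = Some v \<and> snd Z l = Some w)"
    "nodes (fst ?K) = \<gamma> ` nodes (fst ?D) \<union> \<delta> ` nodes (fst Z)"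
    "edges (fst ?K) =
       image_mset (image \<gamma>) (edges (fst ?D)) + image_mset (image \<delta>) (edges (fst Z))"
    "\<And>l u. snd ?K l = Some u \<longleftrightarrow>
       (\<exists>v. snd ?D l = Some v \<and> u = \<gamma> v) \<or> (\<exists>v. snd Z l = Some v \<and> u = \<delta> v)"
    by (rule glue_raw_gluing2[OF D(1) Z]) (rule that; assumption)
  have inj: "l = l'" if "snd W l = Some v" "snd W l' = Some v" "wf_labeled W" for W l l' v
    using wf_labeled_inj[of "fst W" "snd W"] that by simp
  have nod: "v \<in> nodes (fst W)" if "snd W l = Some v" "wf_labeled W" for W l v
    using wf_labeled_node[of "fst W" "snd W"] that by simp
  have lX: "snd ?D l = Some (\<alpha> v) \<longleftrightarrow> snd X l = Some v" if v: "v \<in> nodes (fst X)" for l v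
  proof
    assume "snd ?D l = Some (\<alpha> v)"
    then consider v' where "snd X l = Some v'" "\<alpha> v = \<alpha> v'" | w where "snd Y l = Some w" "\<alpha> v = \<beta> w"
      using D(7) by blast
    then show "snd X l = Some v"
    proof cases
      case 1 then show ?thesis using D(2) v nod X by metis
    next
      case 2
      then obtain l' where "snd X l' = Some v" "snd Y l' = Some w"
        using D(4) v nod[OF 2(1) Y] by blast
      then show ?thesis using inj[OF 2(1) _ Y] by blast
    qed
  qed (use D(7) in blast)
  have lY: "snd ?D l = Some (\<beta> v) \<longleftrightarrow> snd Y l = Some v" if v: "v \<in> nodes (fst Y)" for l v
  proof
    assume "snd ?D l = Some (\<beta> v)"
    then consider w where "snd X l = Some w" "\<beta> v = \<alpha> w" | v' where "snd Y l = Some v'" "\<beta> v = \<beta> v'"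
      using D(7) by blast
    then show "snd Y l = Some v"
    proof cases
      case 2 then show ?thesis using D(3) v nod Y by metis
    next
      case 1
      then have "\<alpha> w = \<beta> v" by simp
      then obtain l' where "snd X l' = Some w" "snd Y l' = Some v"
        using D(4) v nod[OF 1(1) X] by blast
      then show ?thesis using inj[OF 1(1) _ X] by blast
    qed
  qed (use D(7) in blast)
  let ?\<phi> = "\<lambda>i::nat. if i = 0 then \<gamma> \<circ> \<alpha> else if i = 1 then \<gamma> \<circ> \<beta> else \<delta>"
  let ?W = "\<lambda>i::nat. if i = 0 then X else if i = 1 then Y else Z"
  have Dm: "\<And>v. v \<in> nodes (fst X) \<Longrightarrow> \<alpha> v \<in> nodes (fst ?D)"
    "\<And>v. v \<in> nodes (fst Y) \<Longrightarrow> \<beta> v \<in> nodes (fst ?D)" using D(5) by auto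
  have XX: "\<gamma> (\<alpha> v) = \<gamma> (\<alpha> w) \<longleftrightarrow> v = w" if "v \<in> nodes (fst X)" "w \<in> nodes (fst X)" for v w
    using that K(2) D(2) Dm by simp
  have YY: "\<gamma> (\<beta> v) = \<gamma> (\<beta> w) \<longleftrightarrow> v = w" if "v \<in> nodes (fst Y)" "w \<in> nodes (fst Y)" for v w
    using that K(2) D(3) Dm by simp
  have XY: "\<gamma> (\<alpha> v) = \<gamma> (\<beta> w) \<longleftrightarrow> (\<exists>l. snd X l = Some v \<and> snd Y l = Some w)"
    if "v \<in> nodes (fst X)" "w \<in> nodes (fst Y)" for v w
    using that K(2) D(4) Dm by simp
  have XZ: "\<gamma> (\<alpha> v) = \<delta> w \<longleftrightarrow> (\<exists>l. snd X l = Some v \<and> snd Z l = Some w)"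
    if "v \<in> nodes (fst X)" "w \<in> nodes (fst Z)" for v w
    using that K(4) lX Dm by simp
  have YZ: "\<gamma> (\<beta> v) = \<delta> w \<longleftrightarrow> (\<exists>l. snd Y l = Some v \<and> snd Z l = Some w)"
    if "v \<in> nodes (fst Y)" "w \<in> nodes (fst Z)" for v w
    using that K(4) lY Dm by simp
  have YX: "\<gamma> (\<beta> w) = \<gamma> (\<alpha> v) \<longleftrightarrow> (\<exists>l. snd Y l = Some w \<and> snd X l = Some v)"
    if "v \<in> nodes (fst X)" "w \<in> nodes (fst Y)" for v w
    using XY[OF that] by metis
  have ZX: "\<delta> w = \<gamma> (\<alpha> v) \<longleftrightarrow> (\<exists>l. snd Z l = Some w \<and> snd X l = Some v)"
    if "v \<in> nodes (fst X)" "w \<in> nodes (fst Z)" for v w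
    using XZ[OF that] by metis
  have ZY: "\<delta> w = \<gamma> (\<beta> v) \<longleftrightarrow> (\<exists>l. snd Z l = Some w \<and> snd Y l = Some v)"
    if "v \<in> nodes (fst Y)" "w \<in> nodes (fst Z)" for v w
    using YZ[OF that] by metis
  have "is_gluing {0, 1, 2::nat} ?W ?\<phi> ?K"
    unfolding is_gluing_def
  proof (intro conjI)
    show "\<forall>i\<in>{0, 1, 2}. \<forall>j\<in>{0, 1, 2}. \<forall>v\<in>nodes (fst (?W i)). \<forall>w\<in>nodes (fst (?W j)).
      (?\<phi> i v = ?\<phi> j w) =
        ((i = j \<and> v = w) \<or> (\<exists>l. snd (?W i) l = Some v \<and> snd (?W j) l = Some w))"
      by (auto simp: XX YY XY XZ YZ YX ZX ZY K(3))
    show "nodes (fst ?K) = (\<Union>i\<in>{0, 1, 2}. ?\<phi> i ` nodes (fst (?W i)))"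
      unfolding K(5) D(5) by auto
    show "edges (fst ?K) = (\<Sum>i\<in>{0, 1, 2}. image_mset (image (?\<phi> i)) (edges (fst (?W i))))"
      unfolding K(6) D(6) by (simp add: multiset.map_comp comp_def image_image add.assoc)
    show "\<forall>l u. (snd ?K l = Some u) = (\<exists>i\<in>{0, 1, 2}. \<exists>v. snd (?W i) l = Some v \<and> u = ?\<phi> i v)"
      unfolding K(7) D(7) by auto
  qed (use X Y Z K(1) in auto)
  then show ?thesis by blast
qed

lemma glue_raw_assoc:
  assumes X: "wf_labeled X" and Y: "wf_labeled Y" and Z: "wf_labeled Z"
  shows "labeled_iso (glue_raw (glue_raw X Y) Z) (glue_raw X (glue_raw Y Z))"
proof -
  let ?W = "\<lambda>X Y Z. \<lambda>i::nat. if i = 0 then X else if i = 1 then Y else Z"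
  obtain \<phi> where 1: "is_gluing {0, 1, 2::nat} (?W X Y Z) \<phi> (glue_raw (glue_raw X Y) Z)"
    using glue_raw_gluing3[OF X Y Z] by blast
  obtain \<psi> where 2: "is_gluing {0, 1, 2::nat} (?W Y Z X) \<psi> (glue_raw (glue_raw Y Z) X)"
    using glue_raw_gluing3[OF Y Z X] by blast
  have "is_gluing {0, 1, 2::nat} (?W X Y Z) (?W (\<psi> 2) (\<psi> 0) (\<psi> 1)) (glue_raw (glue_raw Y Z) X)"
    using 2 unfolding is_gluing_def by (auto simp: add_ac)
  from is_gluing_unique[OF 1 this]
  have "labeled_iso (glue_raw (glue_raw X Y) Z) (glue_raw (glue_raw Y Z) X)"
    using assms labeled_iso_refl by auto
  then show ?thesis
    using glue_raw_commute[OF wf_glue_raw[OF Y Z] X] labeled_iso_trans by blast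
qed

lemma glue_raw_unit:
  assumes X: "wf_labeled X" and U: "edges U = {#}" "nodes U = ran M"
    "wf_labeled (U, M)" "dom M \<subseteq> dom (snd X)"
  shows "labeled_iso (glue_raw (U, M) X) X"
proof -
  obtain \<alpha> \<beta> where
    1: "is_gluing UNIV (\<lambda>b. if b then X else (U, M)) (\<lambda>b. if b then \<beta> else \<alpha>) (glue_raw (U, M) X)"
    using glue_raw_is_gluing[OF U(3) X] by blast
  define \<gamma> where "\<gamma> = (\<lambda>v. the (snd X (SOME l. M l = Some v)))"
  have g: "\<exists>w. snd X l = Some w \<and> \<gamma> v = w" if "M l = Some v" for l v
  proof -
    have "(SOME l. M l = Some v) = l"
      using that wf_labeled_inj[OF U(3)] by blast
    moreover have "l \<in> dom (snd X)" using that U(4) by blast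
    then obtain w where "snd X l = Some w" by blast
    ultimately show ?thesis unfolding \<gamma>_def by simp
  qed
  have inj: "l = l'" if "snd X l = Some v" "snd X l' = Some v" for l l' v
    using wf_labeled_inj[of "fst X" "snd X"] that X by simp
  have nod: "v \<in> nodes (fst X)" if "snd X l = Some v" for l v
    using wf_labeled_node[of "fst X" "snd X"] that X by simp
  have UM: "\<exists>l. M l = Some v" if "v \<in> nodes U" for v using that U(2) by (auto simp: ran_def)
  have UU: "\<gamma> v = \<gamma> w \<longleftrightarrow> v = w" if "v \<in> nodes U" "w \<in> nodes U" for v w
    using UM[OF that(1)] UM[OF that(2)] g inj by (metis option.inject)
  have UX: "\<gamma> v = w \<longleftrightarrow> (\<exists>l. M l = Some v \<and> snd X l = Some w)" if "v \<in> nodes U" for v w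
    using UM[OF that(1)] g inj by (metis option.inject)
  have XU: "w = \<gamma> v \<longleftrightarrow> (\<exists>l. snd X l = Some w \<and> M l = Some v)" if "v \<in> nodes U" for v w
    using UX[OF that(1)] by metis
  have "is_gluing UNIV (\<lambda>b. if b then X else (U, M)) (\<lambda>b. if b then id else \<gamma>) X"
    unfolding is_gluing_def
  proof (intro conjI)
    show "\<forall>i\<in>UNIV. \<forall>j\<in>UNIV. \<forall>v\<in>nodes (fst (if i then X else (U, M))).
       \<forall>w\<in>nodes (fst (if j then X else (U, M))).
       ((if i then id else \<gamma>) v = (if j then id else \<gamma>) w) =
       ((i = j \<and> v = w) \<or>
        (\<exists>l. snd (if i then X else (U, M)) l = Some v \<and> snd (if j then X else (U, M)) l = Some w))"
    proof (intro ballI)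
      fix i j v w
      assume "v \<in> nodes (fst (if i then X else (U, M)))" "w \<in> nodes (fst (if j then X else (U, M)))"
      then show "((if i then id else \<gamma>) v = (if j then id else \<gamma>) w) =
       ((i = j \<and> v = w) \<or>
        (\<exists>l. snd (if i then X else (U, M)) l = Some v \<and> snd (if j then X else (U, M)) l = Some w))"
        using UU[of v w] UX[of v w] XU[of w v] by (cases i; cases j) auto
    qed
    show "nodes (fst X) =
      (\<Union>i\<in>UNIV. (if i then id else \<gamma>) ` nodes (fst (if i then X else (U, M))))"
      using g UM nod by (auto simp: UNIV_bool) (metis nod)
    show "\<forall>l u. (snd X l = Some u) =
      (\<exists>i\<in>UNIV. \<exists>v. snd (if i then X else (U, M)) l = Some v \<and> u = (if i then id else \<gamma>) v)"
      using g by (auto simp: UNIV_bool)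
  qed (use X U in \<open>auto simp: UNIV_bool\<close>)
  from is_gluing_unique[OF 1 this] show ?thesis using X U labeled_iso_refl by auto
qed

text \<open>
  The class \<open>comm_monoid_add\<close> is used because the library writes the monoid underlying a monoid
  algebra additively: on partially labeled graphs \<open>+\<close> is the gluing product of graphs (not a formal
  sum), \<open>0\<close> is the empty graph, and \<open>\<Sum>\<close> is an iterated gluing product.  The product in
  \<open>plgraph \<Rightarrow>\<^sub>0 'a\<close> is then the bilinear extension of gluing.
\<close>

instantiation plgraph :: comm_monoid_add
begin

lift_definition plus_plgraph :: "plgraph \<Rightarrow> plgraph \<Rightarrow> plgraph" is glue_raw
  by (rule glue_raw_cong)

definition zero_plgraph :: plgraph where "zero_plgraph = edgeless 0"

instance
proof
  have wf: "labeled_iso X X \<Longrightarrow> wf_labeled X" for X by (simp add: labeled_iso_def)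
  fix a b c :: plgraph
  show "a + b + c = a + (b + c)" by transfer (rule glue_raw_assoc; erule wf)
  show "a + b = b + a" by transfer (rule glue_raw_commute; erule wf)
  show "0 + a = a" unfolding zero_plgraph_def
    by transfer (rule glue_raw_unit, auto simp: labeled_iso_def wf_labeled_def)
qed

end

lemma edgeless_labeling:
  fixes k :: nat
  shows "ran (\<lambda>i. if i \<in> {1..k} then Some i else None) = {1..k}"
    and "dom (\<lambda>i. if i \<in> {1..k} then Some i else None) = {1..k}"
    and "inj_on (\<lambda>i. if i \<in> {1..k} then Some i else None) {1..k}"
proof -
  show "ran (\<lambda>i. if i \<in> {1..k} then Some i else None) = {1..k}"
  proof (intro equalityI subsetI)
    fix x assume "x \<in> ran (\<lambda>i. if i \<in> {1..k} then Some i else None)"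
    then show "x \<in> {1..k}"
      unfolding ran_def mem_Collect_eq by (metis option.distinct(1) option.inject)
  next
    fix x assume "x \<in> {1..k}"
    then show "x \<in> ran (\<lambda>i. if i \<in> {1..k} then Some i else None)"
      by (intro ranI[of _ x]) (simp only: if_True)
  qed
  show "dom (\<lambda>i. if i \<in> {1..k} then Some i else None) = {1..k}"
    unfolding dom_def
    by (rule Collect_cong[of _ "\<lambda>i. i \<in> {1..k}", unfolded Collect_mem_eq])
       (simp only: split: if_split, simp)
  show "inj_on (\<lambda>i. if i \<in> {1..k} then Some i else None) {1..k}"
    by (rule inj_onI) (simp only: if_True option.inject)
qed

lemma labels_plus: "labels (G + H) = labels G \<union> labels H"
proof transfer
  fix X Y :: "multigraph \<times> (nat \<rightharpoonup> nat)"
  have "dom (map_option h \<circ> L) = dom L" for h :: "nat \<Rightarrow> nat" and L :: "nat \<rightharpoonup> nat"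
    by (auto simp: dom_def)
  then show "dom (snd (glue_raw X Y)) = dom (snd X) \<union> dom (snd Y)"
    by (simp add: glue_raw_def Let_def)
qed

lemma labels_edgeless: "labels (edgeless k) = {1..k}"
  by transfer (simp only: snd_conv edgeless_labeling)

lemma edgeless_in_PLG [simp]: "edgeless k \<in> PLG k"
  by (simp add: PLG_def labels_edgeless)

lemma plus_in_PLG: "G \<in> PLG k \<Longrightarrow> H \<in> PLG k \<Longrightarrow> G + H \<in> PLG k"
  by (simp add: PLG_def labels_plus)

lemma edgeless_plus: "G \<in> PLG k \<Longrightarrow> edgeless k + G = G"
  unfolding PLG_def mem_Collect_eq
proof transfer
  fix k :: nat and X :: "multigraph \<times> (nat \<rightharpoonup> nat)"
  let ?M = "\<lambda>i. if i \<in> {1..k} then Some i else None"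
  assume "labeled_iso X X" and dom: "dom (snd X) = {1..k}"
  then have X: "wf_labeled X" by (simp add: labeled_iso_def)
  note M = edgeless_labeling[of k]
  have "wf_labeled (Abs_multigraph ({1..k}, {#}), ?M)"
    unfolding wf_labeled_def case_prod_conv M(1,2) using M(3) by simp
  moreover have "nodes (Abs_multigraph ({1..k}, {#})) = ran ?M" unfolding M(1) by simp
  moreover have "dom ?M \<subseteq> dom (snd X)" unfolding M(2) dom by (rule order.refl)
  moreover have "edges (Abs_multigraph ({1..k}, {#})) = {#}" by simp
  ultimately show "labeled_iso (glue_raw (Abs_multigraph ({1..k}, {#}), ?M) X) X"
    by (intro glue_raw_unit[OF X])
qed


section \<open>The algebra of \<open>k\<close>-labeled graphs\<close>

definition graph_algebra :: "nat \<Rightarrow> (plgraph \<Rightarrow>\<^sub>0 'a::field) set" where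
  "graph_algebra k = {g. Poly_Mapping.keys g \<subseteq> PLG k}"

definition of_graph :: "plgraph \<Rightarrow> (plgraph \<Rightarrow>\<^sub>0 'a::field)" where
  "of_graph G = Poly_Mapping.single G 1"

definition scale_quantum :: "'a::field \<Rightarrow> (plgraph \<Rightarrow>\<^sub>0 'a) \<Rightarrow> (plgraph \<Rightarrow>\<^sub>0 'a)" where
  "scale_quantum c g = Poly_Mapping.map ((*) c) g"

definition linear_extension :: "(multigraph \<Rightarrow> 'a::field) \<Rightarrow> (plgraph \<Rightarrow>\<^sub>0 'a) \<Rightarrow> 'a" where
  "linear_extension f g = (\<Sum>G\<in>Poly_Mapping.keys g. Poly_Mapping.lookup g G * unlabeled_value f G)"

text \<open>
  Maps \<open>\<G>[k] \<rightarrow> \<F>\<close> are modelled by functions on all of \<open>plgraph \<Rightarrow>\<^sub>0 'a\<close>, of which only the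
  restrictions to \<open>graph_algebra k\<close> matter.
\<close>

definition linear_map :: "nat \<Rightarrow> ((plgraph \<Rightarrow>\<^sub>0 'a::field) \<Rightarrow> 'a) \<Rightarrow> bool" where
  "linear_map k x \<longleftrightarrow>
     (\<forall>g \<in> graph_algebra k. \<forall>h \<in> graph_algebra k. x (g + h) = x g + x h) \<and>
     (\<forall>c. \<forall>g \<in> graph_algebra k. x (scale_quantum c g) = c * x g)"

definition algebra_hom :: "nat \<Rightarrow> ((plgraph \<Rightarrow>\<^sub>0 'a::field) \<Rightarrow> 'a) \<Rightarrow> bool" where
  "algebra_hom k x \<longleftrightarrow> linear_map k x \<and>
     (\<forall>g \<in> graph_algebra k. \<forall>h \<in> graph_algebra k. x (g * h) = x g * x h) \<and>
     x (of_graph (edgeless k)) = 1"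

definition lin_indep_family :: "nat \<Rightarrow> nat \<Rightarrow> (nat \<Rightarrow> (plgraph \<Rightarrow>\<^sub>0 'a::field) \<Rightarrow> 'a) \<Rightarrow> bool" where
  "lin_indep_family k r x \<longleftrightarrow>
     (\<forall>c. (\<forall>g \<in> graph_algebra k. (\<Sum>i<r. c i * x i g) = 0) \<longrightarrow> (\<forall>i<r. c i = 0))"


section \<open>Connection tensors and symmetric rank\<close>

text \<open>
  A tensor of order \<open>n\<close> is a function on \<open>n\<close>-tuples of elements of \<open>PLG k\<close>; a tuple is a function
  \<open>nat \<Rightarrow> plgraph\<close> of which only the arguments below \<open>n\<close> matter.
\<close>

definition tuples :: "nat \<Rightarrow> nat \<Rightarrow> (nat \<Rightarrow> plgraph) set" where
  "tuples k n = {Gs. \<forall>j<n. Gs j \<in> PLG k}"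

text \<open>
  The factor \<open>edgeless k\<close> makes the empty product the identity of \<open>PLG k\<close>; for \<open>n > 0\<close> it has no
  effect.
\<close>

definition connection_tensor ::
    "(multigraph \<Rightarrow> 'a::field) \<Rightarrow> nat \<Rightarrow> nat \<Rightarrow> (nat \<Rightarrow> plgraph) \<Rightarrow> 'a" where
  "connection_tensor f k n Gs = unlabeled_value f (edgeless k + (\<Sum>j<n. Gs j))"

definition tensor_power :: "(plgraph \<Rightarrow> 'a::field) \<Rightarrow> nat \<Rightarrow> (nat \<Rightarrow> plgraph) \<Rightarrow> 'a" where
  "tensor_power x n Gs = (\<Prod>j<n. x (Gs j))"

definition is_decomposition ::
    "nat \<Rightarrow> nat \<Rightarrow> ((nat \<Rightarrow> plgraph) \<Rightarrow> 'a::field) \<Rightarrow> nat \<Rightarrow> (nat \<Rightarrow> 'a) \<Rightarrow> (nat \<Rightarrow> plgraph \<Rightarrow> 'a) \<Rightarrow> bool"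
  where
  "is_decomposition k n T r a x \<longleftrightarrow>
     (\<forall>Gs \<in> tuples k n. T Gs = (\<Sum>i<r. a i * tensor_power (x i) n Gs))"

text \<open>The infimum over the empty set is \<open>\<infinity>\<close>.\<close>

definition sym_rank :: "nat \<Rightarrow> nat \<Rightarrow> ((nat \<Rightarrow> plgraph) \<Rightarrow> 'a::field) \<Rightarrow> enat" where
  "sym_rank k n T = Inf {enat r | r. \<exists>a x. is_decomposition k n T r a x}"

text \<open>The identification of linear maps \<open>\<G>[k] \<rightarrow> \<F>\<close> with functions on \<open>PLG k\<close>.\<close>

definition on_graphs :: "((plgraph \<Rightarrow>\<^sub>0 'a::field) \<Rightarrow> 'a) \<Rightarrow> plgraph \<Rightarrow> 'a" where
  "on_graphs x G = x (of_graph G)"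

end

theory Submission
  imports Defs "Jordan_Normal_Form.Determinant"
begin

text \<open>
  In a decomposition of order \<open>n\<close> of minimal length \<open>r \<le> n - 1\<close> the vectors \<open>x i\<close> are pairwise
  non-proportional, so their tensor powers of order \<open>n - 2\<close> are linearly independent.  The tensor
  has the same value at \<open>(G H, U, \<dots>)\<close> and at \<open>(G, H, \<dots>)\<close>, where \<open>U\<close> is the edgeless graph, hence
  \<open>x i (G H) x i (U) = x i (G) x i (H)\<close>, and \<open>x i / x i (U)\<close> is a character of the monoid of
  \<open>k\<close>-labeled graphs.  This gives the expansion of all the tensors.  Distinct characters have dual
  elements in the monoid algebra; evaluating a decomposition of length \<open>s\<close> at them factors the
  identity matrix of size \<open>r\<close> through dimension \<open>s\<close>.
\<close>

section \<open>Linear extensions to the monoid algebra\<close>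

text \<open>The functional on the monoid algebra with values \<open>y\<close> on the basis;
  \<open>linear_extension f\<close> is the case \<open>y = unlabeled_value f\<close>.\<close>

definition lin_ext :: "('m \<Rightarrow> 'a::field) \<Rightarrow> ('m \<Rightarrow>\<^sub>0 'a) \<Rightarrow> 'a" where
  "lin_ext y g = (\<Sum>G\<in>Poly_Mapping.keys g. Poly_Mapping.lookup g G * y G)"

lemma lin_ext_superset:
  assumes "finite K" "Poly_Mapping.keys g \<subseteq> K"
  shows "lin_ext y g = (\<Sum>G\<in>K. Poly_Mapping.lookup g G * y G)"
  unfolding lin_ext_def by (rule sum.mono_neutral_left) (use assms in \<open>auto simp: in_keys_iff\<close>)

lemma lin_ext_single [simp]: "lin_ext y (Poly_Mapping.single G c) = c * y G"
  by (simp add: lin_ext_def)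

lemma lin_ext_zero [simp]: "lin_ext y 0 = 0"
  by (simp add: lin_ext_def)

lemma lin_ext_add: "lin_ext y (g + h) = lin_ext y g + lin_ext y h"
proof -
  let ?K = "Poly_Mapping.keys g \<union> Poly_Mapping.keys h"
  have "lin_ext y (g + h) = (\<Sum>G\<in>?K. Poly_Mapping.lookup (g + h) G * y G)"
    by (rule lin_ext_superset) (use keys_add[of g h] in auto)
  also have "\<dots> = (\<Sum>G\<in>?K. Poly_Mapping.lookup g G * y G) + (\<Sum>G\<in>?K. Poly_Mapping.lookup h G * y G)"
    by (simp add: lookup_add distrib_right sum.distrib)
  also have "\<dots> = lin_ext y g + lin_ext y h"
    by (subst (1 2) lin_ext_superset[of ?K]) auto
  finally show ?thesis .
qed

lemma lin_ext_scale: "lin_ext y (scale_quantum c g) = c * lin_ext y g"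
proof -
  have "lin_ext y (scale_quantum c g)
      = (\<Sum>G\<in>Poly_Mapping.keys g. Poly_Mapping.lookup (scale_quantum c g) G * y G)"
    by (rule lin_ext_superset)
       (auto simp: scale_quantum_def in_keys_iff Poly_Mapping.map.rep_eq when_def)
  also have "\<dots> = c * lin_ext y g"
    by (auto simp: lin_ext_def sum_distrib_left scale_quantum_def Poly_Mapping.map.rep_eq
        in_keys_iff when_def intro!: sum.cong)
  finally show ?thesis .
qed

lemma lin_ext_cong:
  assumes "\<And>G. G \<in> Poly_Mapping.keys g \<Longrightarrow> y G = z G"
  shows "lin_ext y g = lin_ext z g"
  unfolding lin_ext_def by (rule sum.cong) (use assms in auto)

lemma lin_ext_sum: "lin_ext (\<lambda>G. \<Sum>i\<in>I. y i G) g = (\<Sum>i\<in>I. lin_ext (y i) g)"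
  unfolding lin_ext_def by (subst sum.swap) (simp add: sum_distrib_left)

lemma lin_ext_mult_left: "lin_ext (\<lambda>G. c * y G) g = c * lin_ext y g"
  by (simp add: lin_ext_def sum_distrib_left mult.left_commute)

lemma lin_ext_mult_right: "lin_ext (\<lambda>G. y G * c) g = lin_ext y g * c"
  using lin_ext_mult_left[of c y g] by (simp add: mult.commute)

lemma poly_mapping_add_induct [case_names zero add_single]:
  fixes g :: "'m \<Rightarrow>\<^sub>0 'b::comm_monoid_add"
  assumes "P 0" and "\<And>g G c. P g \<Longrightarrow> P (g + Poly_Mapping.single G c)"
  shows "P g"
proof (induction g rule: update_induct)
  case (update g G c)
  have "Poly_Mapping.update G c g = g + Poly_Mapping.single G c"
    using update(1) by (intro poly_mapping_eqI)
      (auto simp: lookup_update lookup_add lookup_single when_def in_keys_iff)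
  then show ?case using assms(2)[OF update(3)] by simp
qed (rule assms(1))

text \<open>Additivity in \<open>g\<close> and \<open>h\<close> leaves only products of two basis
  elements. Multiplicativity of a functional thus reduces to the basis.\<close>

lemma lin_ext_times:
  fixes g h :: "'m::comm_monoid_add \<Rightarrow>\<^sub>0 'a::field"
  shows "lin_ext y (g * h) = lin_ext (\<lambda>G. lin_ext (\<lambda>H. y (G + H)) h) g"
proof (induction g rule: poly_mapping_add_induct)
  case (add_single g G c)
  have "lin_ext y (Poly_Mapping.single G c * h) = c * lin_ext (\<lambda>H. y (G + H)) h"
    by (induction h rule: poly_mapping_add_induct)
       (simp_all add: distrib_left lin_ext_add mult_single mult.assoc)
  then show ?case using add_single by (simp add: distrib_right lin_ext_add)
qed simp

text \<open>Both sides are bilinear, hence determined by values on the basis. This permits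
  contracting two tensor slots with algebra elements.\<close>

lemma lin_ext_bilinear:
  fixes x y :: "nat \<Rightarrow> 'm \<Rightarrow> 'a::field"
  assumes "\<And>G H. G \<in> S \<Longrightarrow> H \<in> S \<Longrightarrow>
      (\<Sum>i\<in>I. a i * (x i G * x i H)) = (\<Sum>j\<in>J. b j * (y j G * y j H))"
    and "Poly_Mapping.keys g \<subseteq> S" "Poly_Mapping.keys h \<subseteq> S"
  shows "(\<Sum>i\<in>I. a i * (lin_ext (x i) g * lin_ext (x i) h)) =
    (\<Sum>j\<in>J. b j * (lin_ext (y j) g * lin_ext (y j) h))"
proof -
  have *: "(\<Sum>i\<in>I. a i * (lin_ext (x i) g * lin_ext (x i) h)) =
      lin_ext (\<lambda>G. lin_ext (\<lambda>H. \<Sum>i\<in>I. a i * (x i G * x i H)) h) g"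
    for I and a :: "nat \<Rightarrow> 'a" and x :: "nat \<Rightarrow> 'm \<Rightarrow> 'a"
  proof -
    have "a i * (lin_ext (x i) g * lin_ext (x i) h)
        = lin_ext (\<lambda>G. lin_ext (\<lambda>H. a i * (x i G * x i H)) h) g" for i
      by (simp add: lin_ext_mult_left lin_ext_mult_right)
    then show ?thesis by (simp add: lin_ext_sum)
  qed
  show ?thesis unfolding *
    by (intro lin_ext_cong) (use assms in auto)
qed

text \<open>The dual element is the product of the factors \<open>(p - x l p) / (x i p - x l p)\<close>, \<open>l \<in> J\<close>.\<close>

lemma dual_element:
  fixes x :: "'i \<Rightarrow> 'm::comm_monoid_add \<Rightarrow> 'a::field"
  assumes "finite J" and u: "u \<in> S" and S: "\<And>G H. G \<in> S \<Longrightarrow> H \<in> S \<Longrightarrow> G + H \<in> S"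
    and one: "\<And>l. l \<in> insert i J \<Longrightarrow> x l u = 1"
    and mult: "\<And>l G H. l \<in> insert i J \<Longrightarrow> G \<in> S \<Longrightarrow> H \<in> S \<Longrightarrow> x l (G + H) = x l G * x l H"
    and distinct: "\<And>l. l \<in> J \<Longrightarrow> \<exists>p\<in>S. x i p \<noteq> x l p"
  shows "\<exists>e. Poly_Mapping.keys e \<subseteq> S \<and> lin_ext (x i) e = 1 \<and> (\<forall>l\<in>J. lin_ext (x l) e = 0)"
  using \<open>finite J\<close> one mult distinct
proof (induction J)
  case empty
  then show ?case using u by (intro exI[of _ "Poly_Mapping.single u 1"]) auto
next
  case (insert l J)
  obtain e where e: "Poly_Mapping.keys e \<subseteq> S" "lin_ext (x i) e = 1" "\<forall>l\<in>J. lin_ext (x l) e = 0"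
  proof -
    have "\<exists>e. Poly_Mapping.keys e \<subseteq> S \<and> lin_ext (x i) e = 1 \<and> (\<forall>l\<in>J. lin_ext (x l) e = 0)"
      by (rule insert.IH; rule insert.prems; blast)
    then show thesis using that by blast
  qed
  obtain p where p: "p \<in> S" "x i p \<noteq> x l p" using insert.prems(3)[of l] by auto
  define d where "d = 1 / (x i p - x l p)"
  \<comment> \<open>The constant \<open>x l p\<close> enters as a multiple of \<open>u\<close>, on
    which each \<open>x j\<close> takes the value 1.\<close>
  define q where "q = Poly_Mapping.single p d + Poly_Mapping.single u (- d * x l p)"
  have q: "Poly_Mapping.keys q \<subseteq> S"
    using keys_add[of "Poly_Mapping.single p d" "Poly_Mapping.single u (- d * x l p)"] p u
    unfolding q_def by (auto split: if_splits)
  have xq: "lin_ext (x j) q = d * (x j p - x l p)" if "j \<in> insert i (insert l J)" for j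
    using insert.prems(1)[OF that] by (simp add: q_def lin_ext_add algebra_simps)
  have xeq: "lin_ext (x j) (e * q) = lin_ext (x j) e * lin_ext (x j) q"
    if "j \<in> insert i (insert l J)" for j
  proof -
    have "lin_ext (x j) (e * q) = lin_ext (\<lambda>G. lin_ext (\<lambda>H. x j G * x j H) q) e"
      unfolding lin_ext_times 
      by (intro lin_ext_cong insert.prems(2)[OF that]) (use e q in blast)+
    then show ?thesis by (simp add: lin_ext_mult_left lin_ext_mult_right)
  qed
  have "Poly_Mapping.keys (e * q) \<subseteq> S" using keys_mult[of e q] e(1) q S by blast
  moreover have "lin_ext (x i) (e * q) = 1" using xeq[of i] xq[of i] e p by (simp add: d_def)
  moreover have "\<forall>j\<in>insert l J. lin_ext (x j) (e * q) = 0"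
    using xeq xq e by auto
  ultimately show ?case by blast
qed


section \<open>Factorizations of the identity matrix\<close>

lemma right_inverse_imp_left_inverse:
  fixes A B :: "nat \<Rightarrow> nat \<Rightarrow> 'a::field"
  assumes "\<And>i l. i < r \<Longrightarrow> l < r \<Longrightarrow> (\<Sum>j<r. A i j * B j l) = of_bool (i = l)"
    and "j < r" "m < r"
  shows "(\<Sum>i<r. B j i * A i m) = of_bool (j = m)"
proof -
  let ?A = "mat r r (\<lambda>(i, j). A i j)" and ?B = "mat r r (\<lambda>(i, j). B i j)"
  have "?A * ?B = 1\<^sub>m r"
    by (rule eq_matI) (auto simp: scalar_prod_def atLeast0LessThan assms(1))
  then have "?B * ?A = 1\<^sub>m r"
    by (intro mat_mult_left_right_inverse[of ?A]) auto
  then have "(?B * ?A) $$ (j, m) = 1\<^sub>m r $$ (j, m)" by simp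
  then show ?thesis using assms(2,3) by (simp add: scalar_prod_def atLeast0LessThan)
qed

lemma identity_factorization_le:
  fixes A B :: "nat \<Rightarrow> nat \<Rightarrow> 'a::field"
  assumes "\<And>i l. i < r \<Longrightarrow> l < r \<Longrightarrow> (\<Sum>j<s. A i j * B j l) = of_bool (i = l)"
  shows "r \<le> s"
proof (rule ccontr)
  assume "\<not> r \<le> s"
  then have s: "s < r" by simp
  \<comment> \<open>Row \<open>s\<close> of the padded matrix is zero, which contradicts the
    diagonal entry 1 of its product with \<open>A\<close>.\<close>
  define B' where "B' j l = (if j < s then B j l else 0)" for j l
  have "(\<Sum>j<r. A i j * B' j l) = of_bool (i = l)" if "i < r" "l < r" for i l
  proof -
    have "(\<Sum>j<r. A i j * B' j l) = (\<Sum>j<s. A i j * B' j l)"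
      by (rule sum.mono_neutral_right) (use s in \<open>auto simp: B'_def\<close>)
    then show ?thesis using assms[OF that] by (simp add: B'_def)
  qed
  from right_inverse_imp_left_inverse[of r A B', OF this s s] show False by (simp add: B'_def)
qed


section \<open>Symmetric tensors\<close>

text \<open>
  Contracting one slot with the functional \<open>x l q * ev p - x l p * ev q\<close> kills \<open>x l\<close> but not \<open>x i\<close>.
\<close>

lemma tensor_power_independent:
  fixes x :: "nat \<Rightarrow> plgraph \<Rightarrow> 'a::field"
  assumes "finite I" "card I \<le> Suc m"
    and "\<And>i. i \<in> I \<Longrightarrow> \<exists>p\<in>PLG k. x i p \<noteq> 0"
    and "\<And>i l. i \<in> I \<Longrightarrow> l \<in> I \<Longrightarrow> i \<noteq> l \<Longrightarrow> \<exists>p\<in>PLG k. \<exists>q\<in>PLG k. x i p * x l q \<noteq> x i q * x l p"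
    and "\<And>Gs. Gs \<in> tuples k m \<Longrightarrow> (\<Sum>i\<in>I. c i * tensor_power (x i) m Gs) = 0"
    and "i \<in> I"
  shows "c i = 0"
  using assms
proof (induction m arbitrary: I c)
  case 0
  then have "I = {i}" by (metis One_nat_def card_1_singletonE card_gt_0_iff emptyE le_antisym
        less_eq_Suc_le singletonD)
  then show ?case using "0.prems"(5)[of "\<lambda>_. edgeless k"]
    by (simp add: tensor_power_def tuples_def)
next
  case (Suc m)
  \<comment> \<open>A single remaining vector has no partner to remove; that it is not identically
    zero then suffices.\<close>
  show ?case
  proof (cases "I = {i}")
    case True
    obtain p where p: "p \<in> PLG k" "x i p \<noteq> 0" using Suc.prems by blast
    have "(\<lambda>_. p) \<in> tuples k (Suc m)" using p by (simp add: tuples_def)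
    from Suc.prems(5)[OF this] p True show ?thesis by (simp add: tensor_power_def)
  next
    case False
    then obtain l where l: "l \<in> I" "l \<noteq> i" using \<open>i \<in> I\<close> by blast
    obtain p q where pq: "p \<in> PLG k" "q \<in> PLG k" "x i p * x l q \<noteq> x i q * x l p"
      using Suc.prems(4)[of i l] l \<open>i \<in> I\<close> by blast
    \<comment> \<open>Coefficients after contraction of the last slot; the one at \<open>l\<close>
      is zero, so \<open>l\<close> leaves the index set.\<close>
    define c' where "c' j = c j * (x l q * x j p - x l p * x j q)" for j
    have "c' i = 0"
    proof (rule Suc.IH[of "I - {l}"])
      fix Gs assume Gs: "Gs \<in> tuples k m"
      have upd: "tensor_power y (Suc m) (Gs(m := G)) = tensor_power y m Gs * y G"
        for y :: "plgraph \<Rightarrow> 'a" and G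
        by (simp add: tensor_power_def)
      have ev: "(\<Sum>j\<in>I. c j * (tensor_power (x j) m Gs * x j G)) = 0" if "G \<in> PLG k" for G
        using Suc.prems(5)[of "Gs(m := G)"] Gs that unfolding upd
        by (auto simp: tuples_def less_Suc_eq)
      have "(\<Sum>j\<in>I - {l}. c' j * tensor_power (x j) m Gs) = (\<Sum>j\<in>I. c' j * tensor_power (x j) m Gs)"
        by (rule sum.mono_neutral_left) (use \<open>finite I\<close> in \<open>auto simp: c'_def mult.commute\<close>)
      also have "\<dots> = x l q * (\<Sum>j\<in>I. c j * (tensor_power (x j) m Gs * x j p))
          - x l p * (\<Sum>j\<in>I. c j * (tensor_power (x j) m Gs * x j q))"
        unfolding sum_distrib_left sum_subtractf[symmetric] c'_def
      by (intro sum.cong refl) (simp add: algebra_simps)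
      finally show "(\<Sum>j\<in>I - {l}. c' j * tensor_power (x j) m Gs) = 0"
        using ev pq by simp
    qed (use Suc.prems l in auto)
    then show ?thesis using pq by (auto simp: c'_def mult.commute)
  qed
qed

section \<open>Symmetric rank and minimal decompositions\<close>

lemma sym_rank_le:
  assumes "finite I" "\<And>Gs. Gs \<in> tuples k n \<Longrightarrow> T Gs = (\<Sum>i\<in>I. a i * tensor_power (x i) n Gs)"
  shows "sym_rank k n T \<le> enat (card I)"
proof -
  obtain h where h: "bij_betw h {..<card I} I"
    using ex_bij_betw_nat_finite[OF assms(1)] by (auto simp: atLeast0LessThan)
  have "is_decomposition k n T (card I) (a \<circ> h) (x \<circ> h)"
    unfolding is_decomposition_def
    using assms(2) by (simp add: sum.reindex_bij_betw[OF h, of "\<lambda>i. a i * tensor_power (x i) n _"])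
  then show ?thesis unfolding sym_rank_def by (intro Inf_lower) blast
qed

text \<open>A finite rank excludes the infimum of the empty set, and a nonempty set of extended
  naturals attains its infimum.\<close>

lemma sym_rank_decomposition:
  assumes "sym_rank k n T = enat r"
  obtains a x where "is_decomposition k n T r a x"
proof -
  let ?A = "{enat r | r. \<exists>a x. is_decomposition k n T r a x}"
  have Inf: "Inf ?A = enat r" using assms unfolding sym_rank_def .
  then have "?A \<noteq> {}" by (auto simp: Inf_enat_def simp del: Collect_empty_eq)
  then obtain s where "s \<in> ?A" by (meson ex_in_conv)
  then have "Inf ?A \<in> ?A" by (rule wellorder_InfI)
  then show ?thesis unfolding Inf using that by auto
qed

text \<open>Otherwise a vanishing term could be dropped, or two proportional vectors merged, giving
  a decomposition of length \<open>r - 1\<close>.\<close>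

lemma minimal_decomposition:
  assumes "is_decomposition k n T r a x" "sym_rank k n T = enat r" "n \<ge> 1" "i < r"
  shows "a i \<noteq> 0" and "\<exists>p\<in>PLG k. x i p \<noteq> 0"
    and "l < r \<Longrightarrow> i \<noteq> l \<Longrightarrow> \<exists>p\<in>PLG k. \<exists>q\<in>PLG k. x i p * x l q \<noteq> x i q * x l p"
proof -
  have dec: "T Gs = (\<Sum>i<r. a i * tensor_power (x i) n Gs)" if "Gs \<in> tuples k n" for Gs
    using assms(1) that by (simp add: is_decomposition_def)
  have drop: False if "l < r" "\<And>Gs. Gs \<in> tuples k n \<Longrightarrow>
      T Gs = (\<Sum>i\<in>{..<r} - {l}. b i * tensor_power (x i) n Gs)" for l b
  proof -
    have "enat r \<le> enat (card ({..<r} - {l}))"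
      using sym_rank_le[of "{..<r} - {l}" k n T b x] that(2) assms(2) by simp
    then show False using \<open>l < r\<close> by simp
  qed
  have vanish: False if "\<And>Gs. Gs \<in> tuples k n \<Longrightarrow> a i * tensor_power (x i) n Gs = 0"
    by (rule drop[OF \<open>i < r\<close>, of a]) (use dec that \<open>i < r\<close> in \<open>simp add: sum.remove[of "{..<r}" i]\<close>)
  show "a i \<noteq> 0" using vanish by auto
  show nz: "\<exists>p\<in>PLG k. x i p \<noteq> 0"
  proof (rule ccontr)
    assume "\<not> ?thesis"
    then show False using \<open>n \<ge> 1\<close>
      by (intro vanish) (auto simp: tensor_power_def tuples_def intro!: bexI[of _ 0])
  qed
  show "\<exists>p\<in>PLG k. \<exists>q\<in>PLG k. x i p * x l q \<noteq> x i q * x l p"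
    if l: "l < r" "i \<noteq> l"
  proof (rule ccontr)
    assume "\<not> ?thesis"
    then have minors: "x i p * x l q = x i q * x l p" if "p \<in> PLG k" "q \<in> PLG k" for p q
      using that by blast
    obtain p where p: "p \<in> PLG k" "x i p \<noteq> 0" using nz by blast
    \<comment> \<open>The ratio is read off where \<open>x i\<close> is nonzero; the vanishing
      minors extend it to all of \<open>PLG k\<close>.\<close>
    define c where "c = x l p / x i p"
    have "x l q = c * x i q" if "q \<in> PLG k" for q
      using minors[OF p(1) that] p(2)
      by (simp add: c_def nonzero_eq_divide_eq mult.commute)
    then have tl: "tensor_power (x l) n Gs = c ^ n * tensor_power (x i) n Gs"
      if "Gs \<in> tuples k n" for Gs
      using that by (simp add: tensor_power_def tuples_def prod.distrib)
    show False
    \<comment> \<open>Term \<open>l\<close> is absorbed into term \<open>i\<close>; a power of order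
      \<open>n\<close> scales by \<open>c ^ n\<close>.\<close>
    proof (rule drop[OF l(1), of "a(i := a i + a l * c ^ n)"])
      fix Gs assume Gs: "Gs \<in> tuples k n"
      have R: "{..<r} - {l} - {i} = {..<r} - {i} - {l}" by auto
      have "T Gs = a i * tensor_power (x i) n Gs + (a l * tensor_power (x l) n Gs
          + (\<Sum>j\<in>{..<r} - {i} - {l}. a j * tensor_power (x j) n Gs))"
        using l \<open>i < r\<close> by (simp add: dec[OF Gs] sum.remove[of "{..<r}" i] sum.remove[of "{..<r} - {i}" l])
      also have "\<dots> = (\<Sum>j\<in>{..<r} - {l}. (a(i := a i + a l * c ^ n)) j * tensor_power (x j) n Gs)"
        using l \<open>i < r\<close> by (simp add: sum.remove[of "{..<r} - {l}" i] R tl[OF Gs] algebra_simps)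
      finally show "T Gs = (\<Sum>j\<in>{..<r} - {l}. (a(i := a i + a l * c ^ n)) j * tensor_power (x j) n Gs)" .
    qed
  qed
qed

section \<open>Prescribing the slots of a tensor\<close>

lemma tensor_power_Suc_Suc_shift:
  "tensor_power y (Suc (Suc n)) (case_nat G (case_nat H Gs)) = y G * y H * tensor_power y n Gs"
  by (simp add: tensor_power_def prod.lessThan_Suc_shift del: prod.lessThan_Suc)

lemma is_decompositionD:
  "is_decomposition k n T r a x \<Longrightarrow> Gs \<in> tuples k n \<Longrightarrow>
    T Gs = (\<Sum>i<r. a i * tensor_power (x i) n Gs)"
  by (simp add: is_decomposition_def)

lemma edgeless_plus_edgeless [simp]: "edgeless k + edgeless k = edgeless k"
  by (simp add: edgeless_plus)

lemma edgeless_plus_sum_in_PLG: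
  "Gs \<in> tuples k n \<Longrightarrow> edgeless k + (\<Sum>j<n. Gs j) \<in> PLG k"
  by (induction n) (auto simp: tuples_def plus_in_PLG simp flip: add.assoc)

text \<open>The tensor depends only on the product of its arguments, so \<open>H\<close> may move to
  the first slot if the identity takes its place. This is the source of multiplicativity.\<close>

lemma connection_tensor_merge:
  assumes "Gs \<in> tuples k m" "G \<in> PLG k" "H \<in> PLG k"
  shows "connection_tensor f k (Suc (Suc m)) (case_nat (G + H) (case_nat (edgeless k) Gs)) =
    connection_tensor f k (Suc (Suc m)) (case_nat G (case_nat H Gs))"
proof -
  have "edgeless k + (G + H + (edgeless k + (\<Sum>j<m. Gs j)))
      = (edgeless k + edgeless k) + (G + (H + (\<Sum>j<m. Gs j)))"
    by (simp only: ac_simps)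
  then show ?thesis
    by (simp add: connection_tensor_def sum.lessThan_Suc_shift del: sum.lessThan_Suc)
qed

lemma connection_tensor_pad:
  assumes "G \<in> PLG k"
  shows "connection_tensor f k (Suc n) (case_nat G (\<lambda>_. edgeless k)) = unlabeled_value f G"
proof -
  have "edgeless k + (\<Sum>j<n. edgeless k) = edgeless k"
    by (induction n) (simp_all flip: add.assoc)
  then have "edgeless k + (G + (\<Sum>j<n. edgeless k)) = G"
    using edgeless_plus[OF assms] by (metis add.assoc add.commute)
  then show ?thesis
    by (simp add: connection_tensor_def sum.lessThan_Suc_shift del: sum.lessThan_Suc)
qed


section \<open>Expansions into characters\<close>

text \<open>Every conclusion of the theorem is derived from such an expansion; the rank bound serves
  to produce one in \<open>ex_character_expansion\<close>.\<close>

locale character_expansion =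
  fixes f :: "multigraph \<Rightarrow> 'a::field" and k r :: nat
    and X :: "nat \<Rightarrow> plgraph \<Rightarrow> 'a" and a :: "nat \<Rightarrow> 'a"
  assumes X_edgeless: "i < r \<Longrightarrow> X i (edgeless k) = 1"
    and X_plus: "i < r \<Longrightarrow> G \<in> PLG k \<Longrightarrow> H \<in> PLG k \<Longrightarrow> X i (G + H) = X i G * X i H"
    and X_distinct: "i < r \<Longrightarrow> l < r \<Longrightarrow> i \<noteq> l \<Longrightarrow> \<exists>p\<in>PLG k. X i p \<noteq> X l p"
    and a_nonzero: "i < r \<Longrightarrow> a i \<noteq> 0"
    and expansion: "G \<in> PLG k \<Longrightarrow> unlabeled_value f G = (\<Sum>i<r. a i * X i G)"
begin

text \<open>A character takes a gluing product to the product of its values, so expanding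
  \<open>f\<close> at products gives every order, 0 included.\<close>

lemma decomposition: "is_decomposition k n (connection_tensor f k n) r a X"
  unfolding is_decomposition_def
proof
  fix Gs assume Gs: "Gs \<in> tuples k n"
  have "X i (edgeless k + (\<Sum>j<n. Gs j)) = tensor_power (X i) n Gs" if "i < r" for i
    using Gs
  proof (induction n)
    case (Suc n)
    then have "Gs \<in> tuples k n" "Gs n \<in> PLG k" by (auto simp: tuples_def)
    then show ?case using Suc.IH X_plus[OF that edgeless_plus_sum_in_PLG]
      by (simp add: tensor_power_def flip: add.assoc)
  qed (simp add: X_edgeless[OF that] tensor_power_def)
  then show "connection_tensor f k n Gs = (\<Sum>i<r. a i * tensor_power (X i) n Gs)"
    using expansion[OF edgeless_plus_sum_in_PLG[OF Gs]] by (simp add: connection_tensor_def)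
qed

lemma algebra_hom_lin_ext: "i < r \<Longrightarrow> algebra_hom k (lin_ext (X i))"
  unfolding algebra_hom_def linear_map_def
proof (intro conjI ballI allI)
  fix g h :: "plgraph \<Rightarrow>\<^sub>0 'a"
  assume i: "i < r" and gh: "g \<in> graph_algebra k" "h \<in> graph_algebra k"
  have "lin_ext (X i) (g * h) = lin_ext (\<lambda>G. lin_ext (\<lambda>H. X i G * X i H) h) g"
    unfolding lin_ext_times
    by (intro lin_ext_cong X_plus[OF i]) (use gh in \<open>auto simp: graph_algebra_def\<close>)
  then show "lin_ext (X i) (g * h) = lin_ext (X i) g * lin_ext (X i) h"
    by (simp add: lin_ext_mult_left lin_ext_mult_right)
qed (simp_all add: lin_ext_add lin_ext_scale of_graph_def X_edgeless)

lemma linear_extension_eq: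
  assumes "g \<in> graph_algebra k"
  shows "linear_extension f g = (\<Sum>i<r. a i * lin_ext (X i) g)"
proof -
  have "linear_extension f g = lin_ext (\<lambda>G. \<Sum>i<r. a i * X i G) g"
    using assms unfolding linear_extension_def lin_ext_def graph_algebra_def
    by (intro sum.cong) (auto simp: expansion)
  then show ?thesis by (simp add: lin_ext_sum lin_ext_mult_left)
qed

text \<open>A system biorthogonal to the characters: contracting a slot with \<open>dual i\<close>
  isolates the term of \<open>X i\<close>.\<close>

definition dual :: "nat \<Rightarrow> plgraph \<Rightarrow>\<^sub>0 'a" where
  "dual i = (SOME e. Poly_Mapping.keys e \<subseteq> PLG k \<and> lin_ext (X i) e = 1 \<and>
     (\<forall>l\<in>{..<r} - {i}. lin_ext (X l) e = 0))"

lemma dual: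
  assumes "i < r"
  shows keys_dual: "Poly_Mapping.keys (dual i) \<subseteq> PLG k"
    and lin_ext_dual: "l < r \<Longrightarrow> lin_ext (X l) (dual i) = of_bool (l = i)"
proof -
  have "\<exists>e. Poly_Mapping.keys e \<subseteq> PLG k \<and> lin_ext (X i) e = 1 \<and>
      (\<forall>l\<in>{..<r} - {i}. lin_ext (X l) e = 0)"
    by (rule dual_element[where u = "edgeless k"])
       (use assms X_edgeless X_plus X_distinct plus_in_PLG in auto)
  from someI_ex[OF this, folded dual_def]
  show "Poly_Mapping.keys (dual i) \<subseteq> PLG k"
    and "l < r \<Longrightarrow> lin_ext (X l) (dual i) = of_bool (l = i)" by auto
qed

lemma lin_indep: "lin_indep_family k r (\<lambda>i. lin_ext (X i))"
  unfolding lin_indep_family_def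
proof (intro allI impI)
  fix c i assume c: "\<forall>g\<in>graph_algebra k. (\<Sum>i<r. c i * lin_ext (X i) g) = 0" and i: "i < r"
  have "(\<Sum>l<r. c l * lin_ext (X l) (dual i)) = c i"
    using i by (simp add: lin_ext_dual[OF i] of_bool_def if_distrib cong: if_cong)
  then show "c i = 0" using c keys_dual[OF i] by (simp add: graph_algebra_def)
qed

text \<open>The other \<open>m\<close> slots hold the identity, where each \<open>X i\<close> is 1
  and \<open>y j\<close> leaves the factor \<open>y j (edgeless k) ^ m\<close>.\<close>

lemma two_slots:
  assumes "is_decomposition k (Suc (Suc m)) (connection_tensor f k (Suc (Suc m))) s b y"
    and "G \<in> PLG k" "H \<in> PLG k"
  shows "(\<Sum>i<r. a i * (X i G * X i H)) =
    (\<Sum>j<s. b j * y j (edgeless k) ^ m * (y j G * y j H))"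
proof -
  let ?Gs = "case_nat G (case_nat H (\<lambda>_. edgeless k))"
  have "?Gs \<in> tuples k (Suc (Suc m))"
    using assms(2,3) by (auto simp: tuples_def split: nat.split)
  then have "(\<Sum>i<r. a i * tensor_power (X i) (Suc (Suc m)) ?Gs) =
      (\<Sum>j<s. b j * tensor_power (y j) (Suc (Suc m)) ?Gs)"
    using is_decompositionD[OF assms(1)] is_decompositionD[OF decomposition] by simp
  then show ?thesis unfolding tensor_power_Suc_Suc_shift
    by (simp add: tensor_power_def X_edgeless ac_simps)
qed

text \<open>For uniqueness: once two slots are contracted, the third free slot \<open>P\<close>
  still carries a linear relation among the \<open>y j\<close>.\<close>

lemma three_slots:
  assumes "is_decomposition k (Suc (Suc (Suc m))) (connection_tensor f k (Suc (Suc (Suc m)))) s b y"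
    and "P \<in> PLG k" "G \<in> PLG k" "H \<in> PLG k"
  shows "(\<Sum>i<r. a i * X i P * (X i G * X i H)) =
    (\<Sum>j<s. b j * y j (edgeless k) ^ m * y j P * (y j G * y j H))"
proof -
  let ?Gs = "case_nat G (case_nat H (case_nat P (\<lambda>_. edgeless k)))"
  have "?Gs \<in> tuples k (Suc (Suc (Suc m)))"
    using assms(2-4) by (auto simp: tuples_def split: nat.split)
  then have "(\<Sum>i<r. a i * tensor_power (X i) (Suc (Suc (Suc m))) ?Gs) =
      (\<Sum>j<s. b j * tensor_power (y j) (Suc (Suc (Suc m))) ?Gs)"
    using is_decompositionD[OF assms(1)] is_decompositionD[OF decomposition] by simp
  then show ?thesis unfolding tensor_power_Suc_Suc_shift
    by (simp add: tensor_power_def X_edgeless ac_simps prod.lessThan_Suc_shift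
        del: prod.lessThan_Suc)
qed

text \<open>Contracting two slots with dual elements turns the tensor into the diagonal matrix of
  the \<open>a i\<close>; dividing by \<open>a l\<close> factors the identity of size
  \<open>r\<close> through dimension \<open>s\<close>.\<close>

lemma dual_factorization:
  assumes "is_decomposition k (Suc (Suc m)) (connection_tensor f k (Suc (Suc m))) s b y"
    and "i < r" "l < r"
  shows "(\<Sum>j<s. lin_ext (y j) (dual i) *
      (b j * y j (edgeless k) ^ m * lin_ext (y j) (dual l) / a l)) = of_bool (i = l)"
proof -
  have "(\<Sum>j<s. lin_ext (y j) (dual i) *
      (b j * y j (edgeless k) ^ m * lin_ext (y j) (dual l) / a l)) =
    (\<Sum>j<s. b j * y j (edgeless k) ^ m * (lin_ext (y j) (dual i) * lin_ext (y j) (dual l))) / a l"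
    by (simp add: sum_divide_distrib ac_simps)
  also have "\<dots> = (\<Sum>t<r. a t * (lin_ext (X t) (dual i) * lin_ext (X t) (dual l))) / a l"
    by (subst lin_ext_bilinear[OF two_slots[OF assms(1)], of "PLG k"])
       (use assms keys_dual in auto)
  also have "(\<Sum>t<r. a t * (lin_ext (X t) (dual i) * lin_ext (X t) (dual l))) =
      (\<Sum>t<r. if t = i then a i * of_bool (i = l) else 0)"
    by (rule sum.cong) (use assms lin_ext_dual in auto)
  also have "\<dots> / a l = of_bool (i = l)" using assms a_nonzero by simp
  finally show ?thesis .
qed

lemma sym_rank_eq:
  assumes "n \<ge> 2"
  shows "sym_rank k n (connection_tensor f k n) = enat r"
proof (rule antisym)
  show "sym_rank k n (connection_tensor f k n) \<le> enat r"
    using sym_rank_le[OF finite_lessThan is_decompositionD[OF decomposition]] by simp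
  obtain m where n: "n = Suc (Suc m)" using assms by (metis add_2_eq_Suc le_Suc_ex)
  show "enat r \<le> sym_rank k n (connection_tensor f k n)"
    unfolding sym_rank_def
  proof (rule Inf_greatest)
    fix z assume "z \<in> {enat r | r. \<exists>a x. is_decomposition k n (connection_tensor f k n) r a x}"
    then obtain s b y where s: "z = enat s" "is_decomposition k n (connection_tensor f k n) s b y"
      by auto
    show "enat r \<le> z"
      using identity_factorization_le[OF dual_factorization[OF s(2)[unfolded n]]] s(1) by simp
  qed
qed

text \<open>
  Contracting two slots with \<open>dual i\<close> and \<open>dual l\<close>, \<open>i \<noteq> l\<close>, kills the tensor.  As the \<open>y j\<close> are
  linearly independent, \<open>y j\<close> is nonzero on at most one dual element, so it is a multiple of
  one \<open>X i\<close>.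
\<close>

lemma decomposition_unique:
  assumes "n \<ge> 3" and dec_n: "is_decomposition k n (connection_tensor f k n) r b y"
  shows "\<exists>\<pi>. \<pi> permutes {..<r} \<and> (\<forall>i<r. \<forall>Gs \<in> tuples k n.
    b i * tensor_power (y i) n Gs = a (\<pi> i) * tensor_power (X (\<pi> i)) n Gs)"
proof -
  obtain m where n: "n = Suc (Suc (Suc m))"
    using assms(1) by (metis add_Suc numeral_3_eq_3 le_Suc_ex plus_nat.add_0)
  note dec = dec_n[unfolded n]
  define t where "t j = y j (edgeless k)" for j
  define A where "A i j = lin_ext (y j) (dual i)" for i j
  define B where "B j l = b j * t j ^ Suc m * A l j / a l" for j l
  have AB: "(\<Sum>j<r. A i j * B j l) = of_bool (i = l)" if "i < r" "l < r" for i l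
    using dual_factorization[OF dec that] by (simp add: A_def B_def t_def)
  \<comment> \<open>The decomposition has exactly \<open>r\<close> terms, so the matrices are square
    and the inverse is two-sided.\<close>
  have BA: "(\<Sum>i<r. B j i * A i q) = of_bool (j = q)" if "j < r" "q < r" for j q
    by (rule right_inverse_imp_left_inverse[OF AB that])
  \<comment> \<open>If \<open>b j\<close> or \<open>t j\<close> were zero, row \<open>j\<close> of
    \<open>B\<close> would vanish, since the exponent \<open>Suc m\<close> is positive.\<close>
  have bt: "b j \<noteq> 0" "t j \<noteq> 0" if "j < r" for j
    using BA[OF that that] by (auto simp: B_def)
  \<comment> \<open>The columns of \<open>A\<close> are linearly independent, and hence so are the
    \<open>y j\<close>.\<close>
  have kernel: "c q = 0" if q: "q < r" and c: "\<And>h. h < r \<Longrightarrow> (\<Sum>j<r. c j * A h j) = 0" for c q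
  proof -
    have "c q = (\<Sum>j<r. c j * (\<Sum>h<r. B q h * A h j))"
      using q by (simp add: BA[OF q] of_bool_def if_distrib cong: if_cong)
    also have "\<dots> = (\<Sum>h<r. B q h * (\<Sum>j<r. c j * A h j))"
      unfolding sum_distrib_left by (subst sum.swap) (simp add: ac_simps)
    finally show ?thesis using c by simp
  qed
  have orth: "A i q * A l q = 0" if il: "i < r" "l < r" "i \<noteq> l" and q: "q < r" for i l q
  proof -
    \<comment> \<open>As \<open>i \<noteq> l\<close>, the contraction is zero on the side of the
      characters.\<close>
    have ev: "(\<Sum>j<r. (b j * t j ^ m * (A i j * A l j)) * y j P) = 0" if "P \<in> PLG k" for P
    proof -
      have "(\<Sum>j<r. (b j * t j ^ m * (A i j * A l j)) * y j P) =
          (\<Sum>j<r. b j * t j ^ m * y j P * (A i j * A l j))" by (simp add: ac_simps)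
      also have "\<dots> = (\<Sum>u<r. a u * X u P * (lin_ext (X u) (dual i) * lin_ext (X u) (dual l)))"
        unfolding A_def t_def
        by (rule lin_ext_bilinear[OF three_slots[OF dec that], of "PLG k", symmetric])
           (use il keys_dual in auto)
      also have "\<dots> = 0" using il by (intro sum.neutral) (auto simp: lin_ext_dual)
      finally show ?thesis .
    qed
    have "b q * t q ^ m * (A i q * A l q) = 0"
    proof (rule kernel[OF q])
      fix h assume h: "h < r"
      have "(\<Sum>j<r. b j * t j ^ m * (A i j * A l j) * A h j) =
          lin_ext (\<lambda>P. \<Sum>j<r. (b j * t j ^ m * (A i j * A l j)) * y j P) (dual h)"
        by (simp add: lin_ext_sum lin_ext_mult_left A_def)
      also have "\<dots> = lin_ext (\<lambda>_. 0) (dual h)"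
        by (rule lin_ext_cong) (use keys_dual[OF h] ev in blast)
      finally show "(\<Sum>j<r. b j * t j ^ m * (A i j * A l j) * A h j) = 0"
        by (simp add: lin_ext_def)
    qed
    then show ?thesis using bt[OF q] by simp
  qed
  have contract: "a i * X i H = (\<Sum>j<r. b j * t j ^ Suc m * (A i j * y j H))"
    if i: "i < r" and H: "H \<in> PLG k" for i H
  proof -
    let ?H = "Poly_Mapping.single H (1 :: 'a)"
    have "(\<Sum>u<r. a u * (lin_ext (X u) (dual i) * lin_ext (X u) ?H)) =
        (\<Sum>j<r. b j * y j (edgeless k) ^ Suc m * (lin_ext (y j) (dual i) * lin_ext (y j) ?H))"
      by (rule lin_ext_bilinear[OF two_slots[OF dec], of "PLG k"]) (use i H keys_dual in auto)
    moreover have "(\<Sum>u<r. a u * (lin_ext (X u) (dual i) * lin_ext (X u) ?H)) =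
        (\<Sum>u<r. if u = i then a i * X i H else 0)"
      by (rule sum.cong) (use i in \<open>auto simp: lin_ext_dual\<close>)
    ultimately show ?thesis using i by (simp add: A_def t_def)
  qed
  \<comment> \<open>Multiplying the contracted identities by \<open>B\<close> solves for
    \<open>y q\<close> as a combination of characters.\<close>
  have y: "y q H = (\<Sum>i<r. A i q * X i H)" if q: "q < r" and H: "H \<in> PLG k" for q H
  proof -
    have "(b q * t q ^ Suc m) * (\<Sum>i<r. A i q * X i H) = (\<Sum>i<r. B q i * (a i * X i H))"
      unfolding sum_distrib_left by (rule sum.cong) (auto simp: B_def a_nonzero)
    also have "\<dots> = (\<Sum>i<r. B q i * (\<Sum>j<r. b j * t j ^ Suc m * (A i j * y j H)))"
      using contract[OF _ H] by simp
    also have "\<dots> = (\<Sum>j<r. (b j * t j ^ Suc m * y j H) * (\<Sum>i<r. B q i * A i j))"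
      unfolding sum_distrib_left by (subst sum.swap) (simp add: ac_simps)
    also have "\<dots> = (b q * t q ^ Suc m) * y q H"
      using q by (simp add: BA[OF q] of_bool_def if_distrib cong: if_cong)
    finally show ?thesis using bt[OF q] by simp
  qed
  \<comment> \<open>A zero column would make \<open>y q\<close> vanish, contrary to
    \<open>t q \<noteq> 0\<close>; with \<open>orth\<close> each column has exactly one nonzero
    entry.\<close>
  have "\<exists>i<r. A i q \<noteq> 0" if q: "q < r" for q
  proof (rule ccontr)
    assume "\<not> ?thesis"
    then show False using y[OF q edgeless_in_PLG] bt[OF q] by (simp add: t_def)
  qed
  then obtain \<pi> where \<pi>: "\<And>q. q < r \<Longrightarrow> \<pi> q < r" "\<And>q. q < r \<Longrightarrow> A (\<pi> q) q \<noteq> 0" by metis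
  have A0: "A i q = 0" if "q < r" "i < r" "i \<noteq> \<pi> q" for i q
    using orth[OF that(2) \<pi>(1)[OF that(1)] that(3,1)] \<pi>(2)[OF that(1)] by simp
  have y\<pi>: "y q H = A (\<pi> q) q * X (\<pi> q) H" if "q < r" "H \<in> PLG k" for q H
  proof -
    have "(\<Sum>i<r. A i q * X i H) = (\<Sum>i\<in>{\<pi> q}. A i q * X i H)"
      by (rule sum.mono_neutral_right) (use that \<pi> A0 in auto)
    then show ?thesis using y[OF that] by simp
  qed
  have t\<pi>: "A (\<pi> q) q = t q" if "q < r" for q
    using y\<pi>[OF that edgeless_in_PLG] \<pi>(1)[OF that] by (simp add: X_edgeless t_def)
  have diag: "(\<Sum>i<r. B j i * A i q) = B j (\<pi> q) * t q" if "q < r" for j q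
  proof -
    have "(\<Sum>i<r. B j i * A i q) = (\<Sum>i\<in>{\<pi> q}. B j i * A i q)"
      by (rule sum.mono_neutral_right) (use that \<pi> A0 in auto)
    then show ?thesis using t\<pi>[OF that] by simp
  qed
  \<comment> \<open>If two columns shared their nonzero row, the product of \<open>B\<close> and
    \<open>A\<close> would have a nonzero off-diagonal entry.\<close>
  have inj: "inj_on \<pi> {..<r}"
  proof (rule inj_onI)
    fix q q' assume q: "q \<in> {..<r}" "q' \<in> {..<r}" "\<pi> q = \<pi> q'"
    have "B q (\<pi> q) * t q = 1" using diag[of q q] BA[of q q] q by simp
    moreover have "B q (\<pi> q') * t q' = of_bool (q = q')" using diag[of q' q] BA[of q q'] q by simp
    ultimately show "q = q'" using q bt(2)[of q'] by (cases "q = q'") auto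
  qed
  define \<sigma> where "\<sigma> j = (if j < r then \<pi> j else j)" for j
  have "\<sigma> permutes {..<r}"
  proof (rule bij_imp_permutes)
    have "inj_on \<sigma> {..<r}" "\<sigma> ` {..<r} \<subseteq> {..<r}"
      using inj \<pi>(1) by (auto simp: \<sigma>_def inj_on_def)
    then show "bij_betw \<sigma> {..<r} {..<r}" by (simp add: bij_betw_def endo_inj_surj)
  qed (simp add: \<sigma>_def)
  moreover have "b q * tensor_power (y q) n Gs = a (\<sigma> q) * tensor_power (X (\<sigma> q)) n Gs"
    if q: "q < r" and Gs: "Gs \<in> tuples k n" for q Gs
  proof -
    \<comment> \<open>Only term \<open>q\<close> survives contraction with
      \<open>dual (\<pi> q)\<close>. At the edgeless graph it carries \<open>t q\<close> to the
      power \<open>Suc m + 2 = n\<close>: two further factors come from \<open>A\<close> and the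
      free slot.\<close>
    have "A (\<pi> q) j = 0" if "j < r" "j \<noteq> q" for j
      using inj_onD[OF inj, of q j] q that by (intro A0 \<pi>(1)) auto
    then have "(\<Sum>j<r. b j * t j ^ Suc m * (A (\<pi> q) j * t j)) =
        (\<Sum>j\<in>{q}. b j * t j ^ Suc m * (A (\<pi> q) j * t j))"
      by (intro sum.mono_neutral_right) (use q in auto)
    then have "a (\<pi> q) = b q * t q ^ n"
      using contract[OF \<pi>(1)[OF q] edgeless_in_PLG] \<pi>(1)[OF q] t\<pi>[OF q]
      by (simp add: X_edgeless n ac_simps flip: t_def)
    moreover have "tensor_power (y q) n Gs = t q ^ n * tensor_power (X (\<pi> q)) n Gs"
      using Gs by (simp add: tensor_power_def tuples_def y\<pi>[OF q] t\<pi>[OF q] prod.distrib)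
    ultimately show ?thesis using q by (simp add: \<sigma>_def)
  qed
  ultimately show ?thesis by blast
qed

end

section \<open>From small symmetric rank to characters\<close>

lemma ex_character_expansion:
  assumes "n \<ge> 2" "sym_rank k n (connection_tensor f k n) = enat r" "r \<le> n - 1"
  shows "\<exists>X a. character_expansion f k r X a"
proof -
  obtain m where n: "n = Suc (Suc m)" using assms(1) by (metis add_2_eq_Suc le_Suc_ex)
  obtain c x where dec: "is_decomposition k n (connection_tensor f k n) r c x"
    using sym_rank_decomposition[OF assms(2)] .
  note min = minimal_decomposition[OF dec assms(2)]
  let ?U = "edgeless k"
  have mult: "x i (G + H) * x i ?U = x i G * x i H"
    if i: "i < r" and GH: "G \<in> PLG k" "H \<in> PLG k" for i G H
  proof -
    \<comment> \<open>Two equal values of the tensor give a linear relation among powers of order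
      \<open>m = n - 2\<close>; these are independent because
      \<open>r \<le> n - 1 = Suc m\<close>.\<close>
    have "c i * (x i (G + H) * x i ?U - x i G * x i H) = 0"
    proof (rule tensor_power_independent[of "{..<r}" m k x])
      fix Gs assume Gs: "Gs \<in> tuples k m"
      let ?P = "case_nat (G + H) (case_nat ?U Gs)" and ?Q = "case_nat G (case_nat H Gs)"
      have "?P \<in> tuples k n" "?Q \<in> tuples k n"
        using Gs GH by (auto simp: tuples_def n plus_in_PLG split: nat.split)
      then have "(\<Sum>i<r. c i * tensor_power (x i) n ?P) = (\<Sum>i<r. c i * tensor_power (x i) n ?Q)"
        using connection_tensor_merge[OF Gs GH, of f, folded n] is_decompositionD[OF dec] by simp
      then show "(\<Sum>i<r. c i * (x i (G + H) * x i ?U - x i G * x i H) * tensor_power (x i) m Gs) = 0"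
        unfolding n tensor_power_Suc_Suc_shift by (simp add: algebra_simps sum_subtractf)
    qed (use assms(3) n i min in auto)
    then show ?thesis using min(1)[of i] i n by simp
  qed
  \<comment> \<open>Otherwise \<open>mult\<close> with both factors \<open>p\<close> would give
    \<open>x i p * x i p = 0\<close>.\<close>
  have U: "x i ?U \<noteq> 0" if i: "i < r" for i
  proof
    assume "x i ?U = 0"
    moreover obtain p where "p \<in> PLG k" "x i p \<noteq> 0" using min(2)[of i] i n by auto
    ultimately show False using mult[OF i, of p p] by simp
  qed
  define X where "X i G = x i G / x i ?U" for i G
  \<comment> \<open>Normalizing a vector at the edgeless graph divides its power of order
    \<open>n\<close> by \<open>x i ?U ^ n\<close>, which the coefficient takes up.\<close>
  define a where "a i = c i * x i ?U ^ n" for i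
  have "character_expansion f k r X a"
  proof
    show "X i ?U = 1" if "i < r" for i using U[OF that] by (simp add: X_def)
    show "X i (G + H) = X i G * X i H" if "i < r" "G \<in> PLG k" "H \<in> PLG k" for i G H
      using U[OF that(1)] mult[OF that] by (simp add: X_def divide_simps)
    \<comment> \<open>Equal quotients would make \<open>x i\<close> and \<open>x l\<close>
      proportional, which minimality excludes.\<close>
    show "\<exists>p\<in>PLG k. X i p \<noteq> X l p" if il: "i < r" "l < r" "i \<noteq> l" for i l
    proof (rule ccontr)
      assume "\<not> ?thesis"
      then have eq: "x i p = X l p * x i ?U" "x l p = X l p * x l ?U" if "p \<in> PLG k" for p
        using that U[OF il(1)] U[OF il(2)] by (auto simp: X_def divide_simps)
      obtain p q where pq: "p \<in> PLG k" "q \<in> PLG k" "x i p * x l q \<noteq> x i q * x l p"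
        using min(3)[of i l] il n by auto
      then show False by (simp add: eq[OF pq(1)] eq[OF pq(2)] ac_simps)
    qed
    show "a i \<noteq> 0" if "i < r" for i using U[OF that] min(1)[of i] that n by (simp add: a_def)
    show "unlabeled_value f G = (\<Sum>i<r. a i * X i G)" if G: "G \<in> PLG k" for G
    proof -
      have tp: "tensor_power (x i) n (case_nat G (\<lambda>_. ?U)) = x i ?U ^ n * X i G" if "i < r" for i
        using U[OF that] unfolding n
        by (simp add: tensor_power_def prod.lessThan_Suc_shift X_def del: prod.lessThan_Suc)
      have "case_nat G (\<lambda>_. ?U) \<in> tuples k n" using G by (auto simp: tuples_def split: nat.split)
      then have "unlabeled_value f G = (\<Sum>i<r. c i * tensor_power (x i) n (case_nat G (\<lambda>_. ?U)))"
        using connection_tensor_pad[OF G, of f "Suc m", folded n] is_decompositionD[OF dec] by simp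
      then show ?thesis by (simp add: tp a_def mult.assoc)
    qed
  qed
  then show ?thesis by blast
qed

theorem theorem5p8:
  fixes f :: "multigraph \<Rightarrow> 'a::field" and k r n\<^sub>k :: nat
  assumes "graph_parameter f"
    and "n\<^sub>k \<ge> 2"
    and "sym_rank k n\<^sub>k (connection_tensor f k n\<^sub>k) = enat r"
    and "r \<le> n\<^sub>k - 1"
  shows "(\<forall>n\<ge>2. sym_rank k n (connection_tensor f k n) = enat r) \<and>
    (\<exists>(x :: nat \<Rightarrow> (plgraph \<Rightarrow>\<^sub>0 'a) \<Rightarrow> 'a) (a :: nat \<Rightarrow> 'a).
       (\<forall>i<r. algebra_hom k (x i)) \<and>
       lin_indep_family k r x \<and>
       (\<forall>i<r. a i \<noteq> 0) \<and>
       (\<forall>g \<in> graph_algebra k. linear_extension f g = (\<Sum>i<r. a i * x i g)) \<and>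
       (\<forall>n. is_decomposition k n (connection_tensor f k n) r a (\<lambda>i. on_graphs (x i))) \<and>
       (\<forall>n\<ge>3. \<forall>(b :: nat \<Rightarrow> 'a) (y :: nat \<Rightarrow> (plgraph \<Rightarrow>\<^sub>0 'a) \<Rightarrow> 'a).
          (\<forall>i<r. linear_map k (y i)) \<longrightarrow>
          is_decomposition k n (connection_tensor f k n) r b (\<lambda>i. on_graphs (y i)) \<longrightarrow>
          (\<exists>\<pi>. \<pi> permutes {..<r} \<and>
             (\<forall>i<r. \<forall>Gs \<in> tuples k n.
                b i * tensor_power (on_graphs (y i)) n Gs =
                a (\<pi> i) * tensor_power (on_graphs (x (\<pi> i))) n Gs))))"
proof -
  obtain X a where "character_expansion f k r X a"
    using ex_character_expansion[OF assms(2-4)] by blast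
  then interpret character_expansion f k r X a .
  \<comment> \<open>\<open>on_graphs\<close> undoes the linear extension, so facts about functions
    on graphs transfer to functionals.\<close>
  have X: "on_graphs (lin_ext (X i)) = X i" for i
    by (simp add: fun_eq_iff on_graphs_def of_graph_def)
  show ?thesis
    by (intro conjI exI[of _ "\<lambda>i. lin_ext (X i)"] exI[of _ a] allI impI ballI sym_rank_eq
        algebra_hom_lin_ext lin_indep a_nonzero linear_extension_eq; (assumption)?)
       (simp_all only: X decomposition decomposition_unique)
qed

end
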